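(* Let $n\ge 8$ be an even integer and let $\mathfrak S_{(n,5)}$ be the numerical semigroup generated by $m_0=n^2+3n+1$, $m_1=n^2+3n+2$, $m_2=n^2+3n+3$, $m_3=n^2+4n+3$, $m_4=n^2+4n+4$. Then the tangent cone $G_{\mathfrak m}(\mathfrak S_{(n,5)})$ is Cohen-Macaulay.
   Context: Fix a field $K$. For a numerical semigroup $\Gamma$ generated by $a_1<\dots<a_e$, let $R=K[[t^{a_1},\dots,t^{a_e}]]\subset K[[t]]$ with maximal ideal $\mathfrak m=(t^{a_1},\dots,t^{a_e})$. The tangent cone of $\Gamma$ is the associated graded ring $G_{\mathfrak m}(\Gamma)=\bigoplus_{n\ge 0}\mathfrak m^n/\mathfrak m^{n+1}$. *)

theory Defs
  imports
    "HOL-Computational_Algebra.Formal_Power_Series"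
    "HOL-Algebra.Ideal_Product"
    "HOL-Algebra.QuotRing"
    "HOL-Algebra.Ring_Divisibility"
    "HOL-Library.Extended_Nat"
begin

section \<open>Numerical semigroups and their power series rings\<close>

definition numerical_semigroup :: "nat set \<Rightarrow> bool" where
  "numerical_semigroup \<Gamma> \<longleftrightarrow>
     0 \<in> \<Gamma> \<and> (\<forall>x\<in>\<Gamma>. \<forall>y\<in>\<Gamma>. x + y \<in> \<Gamma>) \<and> finite (- \<Gamma>)"

text \<open>The exponent vectors \<open>u\<close> with \<open>\<Sum>a\<in>A. u a * a = k\<close>; they index the monomials in the
  \<open>t ^ a\<close> (\<open>a \<in> A\<close>) that are equal to \<open>t ^ k\<close>.\<close>

definition factorizations :: "nat set \<Rightarrow> nat \<Rightarrow> (nat \<Rightarrow> nat) set" where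
  "factorizations A k = {u. (\<forall>a. a \<notin> A \<longrightarrow> u a = 0) \<and> (\<Sum>a\<in>A. u a * a) = k}"

definition semigroup_generated_by :: "nat set \<Rightarrow> nat set" where
  "semigroup_generated_by A = {k. factorizations A k \<noteq> {}}"

text \<open>\<open>K[[t ^ a | a \<in> A]]\<close>: the series \<open>\<Sum>u. c u * (\<Prod>a\<in>A. (t ^ a) ^ u a)\<close>, with an arbitrary
  coefficient \<open>c u\<close> in \<open>K\<close> for each exponent vector \<open>u\<close>. The coefficient of \<open>t ^ k\<close> is a finite
  sum when \<open>A\<close> is a finite set of positive integers.\<close>

definition semigroup_ring :: "nat set \<Rightarrow> 'k::field fps ring" where
  "semigroup_ring A =
     \<lparr> carrier = {f. \<exists>c :: (nat \<Rightarrow> nat) \<Rightarrow> 'k. \<forall>k. fps_nth f k = (\<Sum>u\<in>factorizations A k. c u)},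
       mult = (*), one = 1, zero = 0, add = (+) \<rparr>"

definition semigroup_max_ideal :: "nat set \<Rightarrow> 'k::field fps set" where
  "semigroup_max_ideal A = genideal (semigroup_ring A) ((\<lambda>a. fps_X ^ a) ` A)"


section \<open>Associated graded rings\<close>

primrec ideal_power :: "('a, 'b) ring_scheme \<Rightarrow> 'a set \<Rightarrow> nat \<Rightarrow> 'a set" where
  "ideal_power R I 0 = carrier R"
| "ideal_power R I (Suc n) = ideal_prod R (ideal_power R I n) I"

text \<open>An element of \<open>\<Oplus>n. I\<^sup>n / I\<^sup>n\<^sup>+\<^sup>1\<close> is the finitely supported family of its homogeneous components,
  the \<open>n\<close>-th one being a coset of \<open>I\<^sup>n\<^sup>+\<^sup>1\<close>. The class of \<open>x \<in> I\<^sup>i\<close> times the class of \<open>y \<in> I\<^sup>j\<close> is the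
  class of \<open>x \<otimes> y\<close> modulo \<open>I\<^sup>i\<^sup>+\<^sup>j\<^sup>+\<^sup>1\<close>. Sums of such products are taken in \<open>R / I\<^sup>n\<^sup>+\<^sup>1\<close>, which contains
  \<open>I\<^sup>n / I\<^sup>n\<^sup>+\<^sup>1\<close>.\<close>

definition assoc_graded :: "('a, 'b) ring_scheme \<Rightarrow> 'a set \<Rightarrow> (nat \<Rightarrow> 'a set) ring" where
  "assoc_graded R I =
     \<lparr> carrier = {g. (\<forall>n. \<exists>x\<in>ideal_power R I n. g n = a_r_coset R (ideal_power R I (Suc n)) x) \<and>
                     finite {n. g n \<noteq> ideal_power R I (Suc n)}},
       mult = (\<lambda>g h n. finsum (R Quot (ideal_power R I (Suc n)))
                 (\<lambda>i. rcoset_mult R (ideal_power R I (Suc n)) (g i) (h (n - i))) {..n}),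
       one = (\<lambda>n. if n = 0 then a_r_coset R (ideal_power R I 1) \<one>\<^bsub>R\<^esub> else ideal_power R I (Suc n)),
       zero = (\<lambda>n. ideal_power R I (Suc n)),
       add = (\<lambda>g h n. set_add R (g n) (h n)) \<rparr>"

definition tangent_cone :: "nat set \<Rightarrow> (nat \<Rightarrow> 'k::field fps set) ring" where
  "tangent_cone A = assoc_graded (semigroup_ring A) (semigroup_max_ideal A)"


section \<open>Localization\<close>

definition loc_frac :: "('a, 'b) ring_scheme \<Rightarrow> 'a set \<Rightarrow> 'a \<Rightarrow> 'a \<Rightarrow> ('a \<times> 'a) set" where
  "loc_frac R S a s = {(b, t). b \<in> carrier R \<and> t \<in> S \<and>
     (\<exists>u\<in>S. u \<otimes>\<^bsub>R\<^esub> ((t \<otimes>\<^bsub>R\<^esub> a) \<ominus>\<^bsub>R\<^esub> (s \<otimes>\<^bsub>R\<^esub> b)) = \<zero>\<^bsub>R\<^esub>)}"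

text \<open>As in the library's \<^const>\<open>rcoset_mult\<close>, an operation on classes is the union of the results
  over all representatives; these results all coincide.\<close>

definition localization :: "('a, 'b) ring_scheme \<Rightarrow> 'a set \<Rightarrow> ('a \<times> 'a) set ring" where
  "localization R S =
     \<lparr> carrier = {loc_frac R S a s | a s. a \<in> carrier R \<and> s \<in> S},
       mult = (\<lambda>X Y. \<Union>(a, s)\<in>X. \<Union>(b, t)\<in>Y. loc_frac R S (a \<otimes>\<^bsub>R\<^esub> b) (s \<otimes>\<^bsub>R\<^esub> t)),
       one = loc_frac R S \<one>\<^bsub>R\<^esub> \<one>\<^bsub>R\<^esub>,
       zero = loc_frac R S \<zero>\<^bsub>R\<^esub> \<one>\<^bsub>R\<^esub>,
       add = (\<lambda>X Y. \<Union>(a, s)\<in>X. \<Union>(b, t)\<in>Y.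
                loc_frac R S ((a \<otimes>\<^bsub>R\<^esub> t) \<oplus>\<^bsub>R\<^esub> (b \<otimes>\<^bsub>R\<^esub> s)) (s \<otimes>\<^bsub>R\<^esub> t)) \<rparr>"

definition localization_at_prime :: "('a, 'b) ring_scheme \<Rightarrow> 'a set \<Rightarrow> ('a \<times> 'a) set ring" where
  "localization_at_prime R P = localization R (carrier R - P)"


section \<open>Krull dimension, depth and Cohen-Macaulay rings\<close>

definition krull_dim :: "('a, 'b) ring_scheme \<Rightarrow> enat" where
  "krull_dim R = Sup {enat n | n. \<exists>p :: nat \<Rightarrow> 'a set.
     (\<forall>i\<le>n. primeideal (p i) R) \<and> (\<forall>i<n. p i \<subset> p (Suc i))}"

text \<open>The second conjunct says that \<open>x\<^sub>i\<close> is a nonzerodivisor on \<open>R / (x\<^sub>1, \<dots>, x\<^sub>i\<^sub>-\<^sub>1)\<close>.\<close>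

definition regular_sequence :: "('a, 'b) ring_scheme \<Rightarrow> 'a list \<Rightarrow> bool" where
  "regular_sequence R xs \<longleftrightarrow>
     set xs \<subseteq> carrier R \<and>
     (\<forall>i<length xs. \<forall>y\<in>carrier R.
        (xs ! i) \<otimes>\<^bsub>R\<^esub> y \<in> genideal R (set (take i xs)) \<longrightarrow> y \<in> genideal R (set (take i xs))) \<and>
     genideal R (set xs) \<noteq> carrier R"

definition depth :: "('a, 'b) ring_scheme \<Rightarrow> 'a set \<Rightarrow> enat" where
  "depth R I = Sup {enat (length xs) | xs. regular_sequence R xs \<and> set xs \<subseteq> I}"

definition cohen_macaulay_local :: "('a, 'b) ring_scheme \<Rightarrow> bool" where
  "cohen_macaulay_local R \<longleftrightarrow>
     cring R \<and> noetherian_ring R \<and>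
     (\<exists>M. maximalideal M R \<and> (\<forall>M'. maximalideal M' R \<longrightarrow> M' = M) \<and> depth R M = krull_dim R)"

definition cohen_macaulay :: "('a, 'b) ring_scheme \<Rightarrow> bool" where
  "cohen_macaulay R \<longleftrightarrow>
     cring R \<and> noetherian_ring R \<and>
     (\<forall>P. maximalideal P R \<longrightarrow> cohen_macaulay_local (localization_at_prime R P))"


section \<open>Consistency checks for the semigroup ring\<close>

lemma factorizations_bound:
  assumes "finite A" "0 \<notin> A" "u \<in> factorizations A k"
  shows "u a \<le> k"
proof (cases "a \<in> A")
  case True
  then have "u a * a \<le> (\<Sum>a\<in>A. u a * a)"
    using assms(1) by (intro member_le_sum) auto
  moreover have "u a \<le> u a * a"
    using True assms(2) by (cases a) auto
  moreover have "(\<Sum>a\<in>A. u a * a) = k"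
    using assms(3) unfolding factorizations_def by blast
  ultimately show ?thesis by linarith
qed (use assms in \<open>simp add: factorizations_def\<close>)

lemma finite_factorizations:
  assumes "finite A" "0 \<notin> A"
  shows "finite (factorizations A k)"
proof (rule finite_subset)
  show "factorizations A k \<subseteq> {u. \<forall>a. (a \<in> A \<longrightarrow> u a \<in> {..k}) \<and> (a \<notin> A \<longrightarrow> u a = 0)}"
    using factorizations_bound[OF assms] by (auto simp: factorizations_def)
  show "finite {u. \<forall>a. (a \<in> A \<longrightarrow> u a \<in> {..k}) \<and> (a \<notin> A \<longrightarrow> u a = (0::nat))}"
    using assms(1) by (intro finite_set_of_finite_funs) auto
qed

lemma carrier_semigroup_ring:
  assumes "finite A" "0 \<notin> A"
  shows "carrier (semigroup_ring A :: 'k::field fps ring) =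
    {f. \<forall>k. fps_nth f k \<noteq> 0 \<longrightarrow> k \<in> semigroup_generated_by A}"
proof (intro equalityI subsetI)
  fix f :: "'k fps" assume "f \<in> carrier (semigroup_ring A)"
  then show "f \<in> {f. \<forall>k. fps_nth f k \<noteq> 0 \<longrightarrow> k \<in> semigroup_generated_by A}"
    by (auto simp: semigroup_ring_def semigroup_generated_by_def)
next
  fix f :: "'k fps"
  assume "f \<in> {f. \<forall>k. fps_nth f k \<noteq> 0 \<longrightarrow> k \<in> semigroup_generated_by A}"
  then have f: "factorizations A k \<noteq> {}" if "fps_nth f k \<noteq> 0" for k
    using that by (auto simp: semigroup_generated_by_def)
  define w where "w k = (SOME u. u \<in> factorizations A k)" for k
  define c where "c u = (let k = (\<Sum>a\<in>A. u a * a) in if u = w k then fps_nth f k else 0)" for u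
  have "fps_nth f k = (\<Sum>u\<in>factorizations A k. c u)" for k
  proof -
    have "(\<Sum>u\<in>factorizations A k. c u) =
        (\<Sum>u\<in>factorizations A k. if u = w k then fps_nth f k else 0)"
      by (intro sum.cong) (auto simp: c_def factorizations_def)
    also have "\<dots> = (if w k \<in> factorizations A k then fps_nth f k else 0)"
      using finite_factorizations[OF assms] by (simp add: sum.delta')
    also have "\<dots> = fps_nth f k"
    proof (cases "fps_nth f k = 0")
      case False
      then have "w k \<in> factorizations A k"
        unfolding w_def using f[of k] by (simp add: some_in_eq)
      then show ?thesis by simp
    qed simp
    finally show ?thesis by simp
  qed
  then show "f \<in> carrier (semigroup_ring A)"
    by (auto simp: semigroup_ring_def)
qed

lemma semigroup_generated_by_add:
  assumes "x \<in> semigroup_generated_by A" "y \<in> semigroup_generated_by A"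
  shows "x + y \<in> semigroup_generated_by A"
proof -
  obtain u v where "u \<in> factorizations A x" "v \<in> factorizations A y"
    using assms by (auto simp: semigroup_generated_by_def)
  then have "(\<lambda>a. u a + v a) \<in> factorizations A (x + y)"
    by (auto simp: factorizations_def algebra_simps sum.distrib)
  then show ?thesis by (auto simp: semigroup_generated_by_def)
qed

lemma zero_in_semigroup_generated_by: "0 \<in> semigroup_generated_by A"
proof -
  have "(\<lambda>_. 0) \<in> factorizations A 0" by (simp add: factorizations_def)
  then show ?thesis by (auto simp: semigroup_generated_by_def)
qed

lemma generator_in_semigroup_generated_by:
  assumes "finite A" "a \<in> A"
  shows "a \<in> semigroup_generated_by A"
proof -
  have "(\<Sum>b\<in>A. (if b = a then 1 else 0) * b) = (\<Sum>b\<in>A. if b = a then b else 0)"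
    by (intro sum.cong) auto
  then have "(\<lambda>b. if b = a then 1 else 0) \<in> factorizations A a"
    using assms by (auto simp: factorizations_def sum.delta')
  then show ?thesis by (auto simp: semigroup_generated_by_def)
qed

lemma mult_in_semigroup_generated_by:
  assumes "x \<in> semigroup_generated_by A"
  shows "k * x \<in> semigroup_generated_by A"
  by (induction k)
     (auto intro: assms semigroup_generated_by_add zero_in_semigroup_generated_by)

lemma numerical_semigroup_generated_by:
  assumes "finite A" "a \<in> A" "a + 1 \<in> A" "a > 0"
  shows "numerical_semigroup (semigroup_generated_by A)"
proof -
  have "k \<in> semigroup_generated_by A" if "a * a \<le> k" for k
  proof -
    define q r where "q = k div a" and "r = k mod a"
    have "r < a" using assms(4) by (simp add: r_def)
    moreover have "a \<le> q"
      using that assms(4) by (simp add: q_def less_eq_div_iff_mult_less_eq)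
    ultimately have "(q - r) * a + r * (a + 1) = q * a + r"
      by (simp add: diff_mult_distrib add_mult_distrib2 mult_le_mono)
    also have "\<dots> = k" by (simp add: q_def r_def)
    finally have "k = (q - r) * a + r * (a + 1)" ..
    then show ?thesis
      using assms by (metis semigroup_generated_by_add mult_in_semigroup_generated_by
        generator_in_semigroup_generated_by)
  qed
  then have "- semigroup_generated_by A \<subseteq> {..< a * a}"
    by (auto simp: not_le[symmetric])
  then have "finite (- semigroup_generated_by A)" by (rule finite_subset) simp
  then show ?thesis
    by (auto simp: numerical_semigroup_def semigroup_generated_by_add
      zero_in_semigroup_generated_by)
qed

lemma cring_semigroup_ring:
  assumes "finite A" "0 \<notin> A"
  shows "cring (semigroup_ring A :: 'k::field fps ring)"
proof -
  let ?R = "semigroup_ring A :: 'k fps ring"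
  let ?C = "{f :: 'k fps. \<forall>k. fps_nth f k \<noteq> 0 \<longrightarrow> k \<in> semigroup_generated_by A}"
  have C: "carrier ?R = ?C" by (rule carrier_semigroup_ring[OF assms])
  have ops: "x \<otimes>\<^bsub>?R\<^esub> y = x * y" "x \<oplus>\<^bsub>?R\<^esub> y = x + y" "\<one>\<^bsub>?R\<^esub> = 1" "\<zero>\<^bsub>?R\<^esub> = 0" for x y
    by (simp_all add: semigroup_ring_def)
  have mult: "f * g \<in> ?C" if f: "f \<in> ?C" and g: "g \<in> ?C" for f g
  proof -
    have "k \<in> semigroup_generated_by A" if k: "fps_nth (f * g) k \<noteq> 0" for k
    proof -
      have "(\<Sum>i=0..k. fps_nth f i * fps_nth g (k - i)) \<noteq> 0"
        using k by (simp only: fps_mult_nth not_False_eq_True)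
      then obtain i where i: "i \<in> {0..k}" "fps_nth f i * fps_nth g (k - i) \<noteq> 0"
        by (rule sum.not_neutral_contains_not_neutral)
      then have "fps_nth f i \<noteq> 0" "fps_nth g (k - i) \<noteq> 0" by simp_all
      then have "i + (k - i) \<in> semigroup_generated_by A"
        using f g by (intro semigroup_generated_by_add) blast+
      then show ?thesis using i by simp
    qed
    then show ?thesis by blast
  qed
  have add: "f + g \<in> ?C" if f: "f \<in> ?C" and g: "g \<in> ?C" for f g
  proof -
    have "k \<in> semigroup_generated_by A" if k: "fps_nth (f + g) k \<noteq> 0" for k
    proof -
      have "fps_nth f k \<noteq> 0 \<or> fps_nth g k \<noteq> 0" using k by auto
      then show ?thesis using f g by blast
    qed
    then show ?thesis by blast
  qed
  have zero: "0 \<in> ?C" by simp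
  have one: "1 \<in> ?C" by (simp add: zero_in_semigroup_generated_by)
  have uminus: "- f \<in> ?C" if "f \<in> ?C" for f using that by simp
  show ?thesis
  proof (rule cringI)
    show "abelian_group ?R"
    proof (rule abelian_groupI, unfold C ops)
      fix x :: "'k fps" assume "x \<in> ?C"
      then show "\<exists>y\<in>?C. y + x = 0" by (intro bexI[of _ "- x"] uminus) simp_all
    qed (assumption | rule add zero add.assoc add.commute add_0_left)+
    show "comm_monoid ?R"
      by (rule comm_monoidI, unfold C ops) (assumption | rule mult one mult.assoc mult.commute mult_1_left)+
  qed (unfold ops, rule distrib_right)
qed

end

theory Submission
  imports Defs "HOL-Computational_Algebra.Polynomial"
begin

text \<open>Write \<open>a = n\<^sup>2 + 3 n + 1\<close> for the smallest generator, so that the generators are \<open>a + d\<close> with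
  \<open>d\<close> in \<open>D = {0, 1, 2, n + 2, n + 3}\<close>. The arithmetic heart of the matter is that, for \<open>k \<ge> n\<close>, the
  sums of \<open>k\<close> elements of \<open>D\<close> fill the whole interval from \<open>0\<close> to \<open>k (n + 3)\<close>
  (\<open>consecutive_sums\<close>). If a semigroup element \<open>s \<ge> r a\<close> is a sum of only \<open>l < r\<close> generators, then
  \<open>l (n + 3) \<ge> s - l a \<ge> a > n (n + 3)\<close>, so \<open>l > n\<close>; since \<open>s - r a\<close> is then at most
  \<open>r (n + 3)\<close>, it is a sum of \<open>r\<close> elements of \<open>D\<close>, and \<open>s\<close> is also a sum of \<open>r\<close> generators. Thus
  the longest factorization of \<open>s\<close> has length \<open>s div a\<close>, and \<open>m\<^sup>r\<close> consists of \<^emph>\<open>all\<close> series in the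
  semigroup ring \<open>R\<close> that have order at least \<open>r a\<close> (\<open>ideal_power_eq_filt\<close>).

  For any semigroup ring with this property the tangent cone \<open>G\<close> is easy to describe. Let \<open>X\<close> be
  the class of \<open>t\<^sup>a\<close> in degree one. Multiplication by \<open>t\<^sup>a\<close> raises orders by exactly \<open>a\<close>, so no
  nonzero polynomial in \<open>X\<close> is a zero divisor (\<open>lift_nonzerodivisor\<close>). A class in degree \<open>r\<close> that
  is represented by a series of order greater than \<open>r a\<close> gains at least one unit of excess order
  with each factor, so its \<open>a\<close>-th power vanishes (\<open>form_nilpotent\<close>). Hence \<open>G = K[X] + N\<close> with \<open>N\<close>
  the nilradical. Finally \<open>G\<close> is generated as a \<open>K[X]\<close>-module by the classes of \<open>t\<^sup>w\<close> with \<open>w\<close> in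
  the finite Apery set, so it is Noetherian.

  These facts give the Cohen-Macaulay property (\<open>cohen_macaulay_of_regular_poly_subring\<close>). A
  maximal ideal \<open>P\<close> of \<open>G\<close> contains \<open>N\<close> and meets \<open>K[X]\<close> in an ideal generated by a nonzero
  \<open>p\<close>. In the localization at \<open>P\<close> every element that is not nilpotent divides a power of \<open>p\<close>, and
  every element of the maximal ideal has a power that is a multiple of \<open>p\<close>. Therefore its only
  primes are the nilradical and the maximal ideal, so its dimension is one; its depth is one
  because \<open>p\<close> is not a zero divisor.\<close>


section \<open>One-dimensional Cohen-Macaulay local rings\<close>

definition nilradical :: "('a, 'b) ring_scheme \<Rightarrow> 'a set" where
  "nilradical R = {x \<in> carrier R. \<exists>m::nat. x [^]\<^bsub>R\<^esub> m = \<zero>\<^bsub>R\<^esub>}"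

context cring
begin

lemma add_pow_eq_mult_add_pow:
  assumes "x \<in> carrier R" "y \<in> carrier R"
  shows "\<exists>b\<in>carrier R. (x \<oplus> y) [^] (m::nat) = x \<otimes> b \<oplus> y [^] m"
proof (induction m)
  case 0
  then show ?case using assms by (intro bexI[of _ \<zero>]) auto
next
  case (Suc m)
  then obtain b where b: "b \<in> carrier R" "(x \<oplus> y) [^] m = x \<otimes> b \<oplus> y [^] m" by blast
  have "(x \<oplus> y) [^] Suc m = (x \<otimes> b \<oplus> y [^] m) \<otimes> (x \<oplus> y)" using b by simp
  also have "\<dots> = x \<otimes> (b \<otimes> (x \<oplus> y) \<oplus> y [^] m) \<oplus> y [^] m \<otimes> y"
  proof -
    have "y [^] m \<in> carrier R" using assms by simp
    then show ?thesis using assms b(1) by algebra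
  qed
  finally show ?case
    using assms b by (intro bexI[of _ "b \<otimes> (x \<oplus> y) \<oplus> y [^] m"]) auto
qed

text \<open>Inductive substitute for the binomial theorem: expanding one factor at a time leaves a multiple
  of \<open>a\<close> or of \<open>b\<close>, and each of these has used up one of the two exponents. The annihilated
  element \<open>c\<close> is what makes the induction go through.\<close>

lemma add_pow_annihilated:
  assumes "a \<in> carrier R" "b \<in> carrier R" "c \<in> carrier R"
    and "c \<otimes> a [^] (m::nat) = \<zero>" "c \<otimes> b [^] (l::nat) = \<zero>"
  shows "c \<otimes> (a \<oplus> b) [^] (m + l) = \<zero>"
  using assms(3-)
proof (induction "m + l" arbitrary: c m l)
  case 0
  then show ?case using assms by simp
next
  case (Suc k)
  show ?case
  proof (cases "m = 0 \<or> l = 0")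
    case True
    then have "c = \<zero>" using Suc.prems by auto
    then show ?thesis using assms by simp
  next
    case False
    then obtain m' l' where ml: "m = Suc m'" "l = Suc l'" by (meson not0_implies_Suc)
    have k: "k = m' + l" "k = m + l'" using Suc.hyps(2) ml by auto
    note [simp] = Suc.prems(1) assms(1,2)
    have "(c \<otimes> a) \<otimes> a [^] m' = \<zero>"
      using Suc.prems(2) ml by (simp add: m_assoc m_comm[of a])
    moreover have "(c \<otimes> a) \<otimes> b [^] l = a \<otimes> (c \<otimes> b [^] l)" by (simp add: m_ac)
    ultimately have 1: "(c \<otimes> a) \<otimes> (a \<oplus> b) [^] k = \<zero>"
      using Suc.hyps(1)[OF k(1), of "c \<otimes> a"] Suc.prems k by simp
    have "(c \<otimes> b) \<otimes> b [^] l' = \<zero>"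
      using Suc.prems(3) ml by (simp add: m_assoc m_comm[of b])
    moreover have "(c \<otimes> b) \<otimes> a [^] m = b \<otimes> (c \<otimes> a [^] m)" by (simp add: m_ac)
    ultimately have 2: "(c \<otimes> b) \<otimes> (a \<oplus> b) [^] k = \<zero>"
      using Suc.hyps(1)[OF k(2), of "c \<otimes> b"] Suc.prems k by simp
    have "c \<otimes> (a \<oplus> b) [^] Suc k = (c \<otimes> a) \<otimes> (a \<oplus> b) [^] k \<oplus> (c \<otimes> b) \<otimes> (a \<oplus> b) [^] k"
    proof -
      have "c \<otimes> (p \<otimes> (a \<oplus> b)) = (c \<otimes> a) \<otimes> p \<oplus> (c \<otimes> b) \<otimes> p" if "p \<in> carrier R" for p
        using that Suc.prems(1) assms(1,2) by algebra
      then show ?thesis by simp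
    qed
    then show ?thesis using 1 2 Suc.hyps(2)[symmetric] by simp
  qed
qed

lemma nilradical_ideal: "ideal (nilradical R) R"
proof (rule idealI)
  show "ring R" by (rule ring_axioms)
  have mult: "x \<otimes> y \<in> nilradical R" if "x \<in> nilradical R" "y \<in> carrier R" for x y
  proof -
    obtain m :: nat where "x \<in> carrier R" "x [^] m = \<zero>"
      using \<open>x \<in> _\<close> by (auto simp: nilradical_def)
    then have "(x \<otimes> y) [^] m = \<zero>" using that(2) by (simp add: nat_pow_distrib)
    then show ?thesis using that \<open>x \<in> carrier R\<close> by (auto simp: nilradical_def)
  qed
  have sub: "nilradical R \<subseteq> carrier R" by (auto simp: nilradical_def)
  show "x \<otimes> a \<in> nilradical R" "a \<otimes> x \<in> nilradical R"
    if "a \<in> nilradical R" "x \<in> carrier R" for a x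
    using mult[OF that] sub that by (auto simp: m_comm)
  have add: "x \<oplus> y \<in> nilradical R" if xy: "x \<in> nilradical R" "y \<in> nilradical R" for x y
  proof -
    obtain m l :: nat where "x \<in> carrier R" "x [^] m = \<zero>" "y \<in> carrier R" "y [^] l = \<zero>"
      using xy by (auto simp: nilradical_def)
    then show ?thesis
      using add_pow_annihilated[of x y \<one> m l] by (auto simp: nilradical_def intro!: exI[of _ "m + l"])
  qed
  show "subgroup (nilradical R) (add_monoid R)"
  proof (rule add.subgroupI)
    show "nilradical R \<subseteq> carrier R" by (rule sub)
    have "\<zero> [^] (1::nat) = \<zero>" by simp
    then have "\<zero> \<in> nilradical R" unfolding nilradical_def by blast
    then show "nilradical R \<noteq> {}" by blast
    show "\<ominus> x \<in> nilradical R" if "x \<in> nilradical R" for x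
      using mult[OF that, of "\<ominus> \<one>"] that sub by (auto simp: r_minus)
    show "x \<oplus> y \<in> nilradical R" if "x \<in> nilradical R" "y \<in> nilradical R" for x y
      by (rule add[OF that])
  qed
qed

lemma prime_contains_base:
  assumes "primeideal Q R" "x \<in> carrier R" "x [^] (m::nat) \<in> Q"
  shows "x \<in> Q"
proof -
  interpret Q: primeideal Q R by fact
  show ?thesis using assms(3)
  proof (induction m)
    case 0
    then show ?case using Q.I_notcarr Q.one_imp_carrier by auto
  next
    case (Suc m)
    then show ?case using Q.I_prime[of "x [^] m" x] assms(2) by auto
  qed
qed

lemma nilradical_subset_prime:
  assumes "primeideal Q R"
  shows "nilradical R \<subseteq> Q"
proof
  interpret Q: primeideal Q R by fact
  fix x assume "x \<in> nilradical R"
  then obtain m :: nat where m: "x \<in> carrier R" "x [^] m = \<zero>" by (auto simp: nilradical_def)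
  then have "x [^] m \<in> Q" by simp
  then show "x \<in> Q" using prime_contains_base assms m(1) by blast
qed

lemma nonzerodivisor_pow:
  assumes "w \<in> carrier R" "y \<in> carrier R" "w [^] (m::nat) \<otimes> y = \<zero>"
    and "\<And>y. y \<in> carrier R \<Longrightarrow> w \<otimes> y = \<zero> \<Longrightarrow> y = \<zero>"
  shows "y = \<zero>"
  using assms(2,3)
proof (induction m arbitrary: y)
  case (Suc m)
  then have "w [^] m \<otimes> (w \<otimes> y) = \<zero>" using assms(1) by (simp add: m_assoc)
  then have "w \<otimes> y = \<zero>" using Suc assms(1) by simp
  then show ?case using assms(4) Suc by simp
qed simp

lemma nonzerodivisor_not_nilpotent:
  assumes "w \<in> carrier R" "\<one> \<noteq> \<zero>"
    and "\<And>y. y \<in> carrier R \<Longrightarrow> w \<otimes> y = \<zero> \<Longrightarrow> y = \<zero>"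
  shows "w \<notin> nilradical R"
proof
  assume "w \<in> nilradical R"
  then obtain m :: nat where "w [^] m = \<zero>" unfolding nilradical_def by blast
  then have "w [^] m \<otimes> \<one> = \<zero>" by simp
  then show False using nonzerodivisor_pow[OF assms(1) one_closed _ assms(3)] assms(2) by blast
qed

lemma regular_element_pow:
  assumes I: "ideal I R" and x: "x \<in> carrier R"
    and reg: "\<And>y. y \<in> carrier R \<Longrightarrow> x \<otimes> y \<in> I \<Longrightarrow> y \<in> I"
    and mem: "x [^] (m::nat) \<in> I"
  shows "\<one> \<in> I"
  using mem
proof (induction m)
  case (Suc m)
  then show ?case using reg[of "x [^] m"] x by (simp add: m_comm)
qed simp

text \<open>The two divisibility hypotheses say that \<open>w\<close> is a parameter in a strong form. A prime ideal with
  an element that is not nilpotent contains a power of \<open>w\<close>, hence \<open>w\<close>, hence the whole of \<open>M\<close>; so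
  the nilradical and \<open>M\<close> are the only primes and the dimension is one. The element \<open>w\<close> gives depth
  at least one. A regular sequence cannot have a second member \<open>b\<close>: its first member \<open>a\<close> is not
  nilpotent and so divides a power of \<open>w\<close>, therefore some power of \<open>b\<close> is a multiple of \<open>a\<close>, and
  cancelling \<open>b\<close> modulo \<open>a\<close> would make \<open>a\<close> a unit.\<close>

theorem cohen_macaulay_local_of_parameter:
  assumes noetherian: "noetherian_ring R" and max: "maximalideal M R"
    and local: "\<And>x. x \<in> carrier R \<Longrightarrow> x \<notin> M \<Longrightarrow> x \<in> Units R"
    and w: "w \<in> M" and w_regular: "\<And>y. y \<in> carrier R \<Longrightarrow> w \<otimes> y = \<zero> \<Longrightarrow> y = \<zero>"
    and divides_pow: "\<And>x. x \<in> carrier R \<Longrightarrow> x \<notin> nilradical R \<Longrightarrow>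
        \<exists>k::nat. \<exists>y\<in>carrier R. w [^] k = x \<otimes> y"
    and pow_multiple: "\<And>x. x \<in> M \<Longrightarrow> \<exists>e::nat. \<exists>y\<in>carrier R. x [^] e = w \<otimes> y"
  shows "cohen_macaulay_local R"
proof -
  interpret M: maximalideal M R by fact
  let ?N = "nilradical R"
  have Mprime: "primeideal M R" by (rule maximalideal_prime[OF max])
  have wc: "w \<in> carrier R" using w M.a_subset by blast
  have one_nM: "\<one> \<notin> M" using M.one_imp_carrier M.I_notcarr by blast
  then have one_nz: "\<one> \<noteq> \<zero>" by auto
  have proper: "J \<subseteq> M" if J: "ideal J R" "\<one> \<notin> J" for J
  proof
    interpret J: ideal J R by fact
    fix x assume x: "x \<in> J"
    show "x \<in> M"
    proof (rule ccontr)
      assume "x \<notin> M"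
      then have u: "x \<in> Units R" using local x J.a_subset by blast
      then have "inv x \<otimes> x \<in> J" using x by (intro J.I_l_closed) auto
      then show False using u J(2) by simp
    qed
  qed
  have w_nN: "w \<notin> ?N"
    by (rule nonzerodivisor_not_nilpotent[OF wc one_nz w_regular])
  interpret N: ideal ?N R by (rule nilradical_ideal)
  have Nprime: "primeideal ?N R"
  proof (rule primeidealI)
    show "ideal ?N R" "cring R" by unfold_locales
    show "carrier R \<noteq> ?N" using w_nN wc by blast
    fix x y assume x: "x \<in> carrier R" and y: "y \<in> carrier R" and xy: "x \<otimes> y \<in> ?N"
    show "x \<in> ?N \<or> y \<in> ?N"
    proof (rule ccontr)
      assume "\<not> (x \<in> ?N \<or> y \<in> ?N)"
      then obtain k l :: nat and a b where ab: "a \<in> carrier R" "b \<in> carrier R"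
        "w [^] k = x \<otimes> a" "w [^] l = y \<otimes> b" using divides_pow x y by meson
      have "w [^] (k + l) = w [^] k \<otimes> w [^] l" using wc by (simp only: nat_pow_mult)
      also have "\<dots> = (x \<otimes> y) \<otimes> (a \<otimes> b)" using ab x y by (simp add: m_ac)
      finally have wkl: "w [^] (k + l) = (x \<otimes> y) \<otimes> (a \<otimes> b)" .
      then have "w [^] (k + l) \<in> ?N" using N.I_r_closed[OF xy] ab wkl by simp
      then obtain m :: nat where "(w [^] (k + l)) [^] m = \<zero>" unfolding nilradical_def by blast
      then have "w [^] ((k + l) * m) = \<zero>" using wc by (simp only: nat_pow_pow)
      then have "w \<in> ?N" using wc unfolding nilradical_def by blast
      then show False using w_nN by simp
    qed
  qed
  have primes: "Q = ?N \<or> Q = M" if Q: "primeideal Q R" for Q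
  proof (cases "Q = ?N")
    case False
    interpret Q: primeideal Q R by fact
    have "\<one> \<notin> Q" using Q.one_imp_carrier Q.I_notcarr by blast
    then have QM: "Q \<subseteq> M" by (rule proper[OF Q.is_ideal])
    obtain x where x: "x \<in> Q" "x \<notin> ?N" using False nilradical_subset_prime[OF Q] by blast
    then obtain k :: nat and y where y: "y \<in> carrier R" "w [^] k = x \<otimes> y"
      using divides_pow Q.a_subset by blast
    then have "w [^] k \<in> Q" using x Q.I_r_closed by auto
    then have wQ: "w \<in> Q" by (rule prime_contains_base[OF Q wc])
    have "M \<subseteq> Q"
    proof
      fix x assume x: "x \<in> M"
      then obtain e :: nat and y where "y \<in> carrier R" "x [^] e = w \<otimes> y"
        using pow_multiple by blast
      then have "x [^] e \<in> Q" using wQ Q.I_r_closed by auto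
      then show "x \<in> Q" using prime_contains_base[OF Q] x M.a_subset by blast
    qed
    then show ?thesis using QM by blast
  qed simp
  have NM: "?N \<subset> M" using nilradical_subset_prime[OF Mprime] w w_nN by blast

  have "krull_dim R = 1"
    unfolding krull_dim_def
  proof (rule antisym)
    show "Sup {enat n |n. \<exists>p. (\<forall>i\<le>n. primeideal (p i) R) \<and> (\<forall>i<n. p i \<subset> p (Suc i))} \<le> 1"
    proof (rule Sup_least, clarsimp)
      fix n p assume p: "\<forall>i\<le>n. primeideal (p i) R" "\<forall>i<n. p i \<subset> p (Suc i)"
      show "enat n \<le> 1"
      proof (rule ccontr)
        assume "\<not> enat n \<le> 1"
        then have "n \<ge> 2" by (simp add: one_enat_def)
        then have "p 0 \<subset> p 1" "p 1 \<subset> p 2" "primeideal (p 0) R" "primeideal (p 1) R" "primeideal (p 2) R"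
          using p by (auto simp: numeral_2_eq_2)
        then show False using primes[of "p 0"] primes[of "p 1"] primes[of "p 2"] NM by auto
      qed
    qed
    have "\<exists>p. (\<forall>i\<le>1. primeideal (p i) R) \<and> (\<forall>i<1. p i \<subset> p (Suc i))"
      using Nprime Mprime NM by (intro exI[of _ "\<lambda>i::nat. if i = 0 then ?N else M"]) auto
    then show "1 \<le> Sup {enat n |n. \<exists>p. (\<forall>i\<le>n. primeideal (p i) R) \<and> (\<forall>i<n. p i \<subset> p (Suc i))}"
      by (intro Sup_upper) (auto simp: one_enat_def)
  qed
  moreover have "depth R M = 1"
    unfolding depth_def
  proof (rule antisym)
    have empty: "Idl {} = {\<zero>}"
      using genideal_minimal[OF zeroideal, of "{}"] genideal_ideal[of "{}"]
      by (auto simp: additive_subgroup.zero_closed[OF ideal.axioms(1)])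
    have M_genideal: "Idl X \<subseteq> M" if "X \<subseteq> M" for X
      by (rule genideal_minimal[OF M.is_ideal that])
    have "\<one> \<notin> Idl {w}" using M_genideal[of "{w}"] w one_nM by blast
    then have "Idl {w} \<noteq> carrier R" by blast
    then have "regular_sequence R [w]"
      unfolding regular_sequence_def using wc w_regular by (simp add: empty)
    then have "enat (length [w]) \<in> {enat (length xs) |xs. regular_sequence R xs \<and> set xs \<subseteq> M}"
      using w by (intro CollectI exI[of _ "[w]"]) simp
    then show "1 \<le> Sup {enat (length xs) |xs. regular_sequence R xs \<and> set xs \<subseteq> M}"
      by (intro Sup_upper) (simp add: one_enat_def)
    show "Sup {enat (length xs) |xs. regular_sequence R xs \<and> set xs \<subseteq> M} \<le> 1"
    proof (rule Sup_least, clarsimp)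
      fix xs assume reg: "regular_sequence R xs" and xs: "set xs \<subseteq> M"
      show "enat (length xs) \<le> 1"
      proof (rule ccontr)
        assume "\<not> enat (length xs) \<le> 1"
        then have len: "length xs \<ge> 2" by (simp add: one_enat_def)
        then obtain a b ys where ab: "xs = a # b # ys"
          by (metis Suc_le_length_iff numeral_2_eq_2)
        then have aM: "a \<in> M" and bM: "b \<in> M" using xs by auto
        then have a: "a \<in> carrier R" and b: "b \<in> carrier R" using M.a_subset by auto
        have seq: "y \<in> Idl (set (take i xs))"
          if "i < length xs" "y \<in> carrier R" "(xs ! i) \<otimes> y \<in> Idl (set (take i xs))" for i y
          using reg that unfolding regular_sequence_def by blast
        have reg_a: "y = \<zero>" if "y \<in> carrier R" "a \<otimes> y = \<zero>" for y
          using seq[of 0 y] that by (simp add: ab empty)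
        have reg_b: "y \<in> Idl {a}" if "y \<in> carrier R" "b \<otimes> y \<in> Idl {a}" for y
          using seq[of 1 y] that by (simp add: ab)
        have "a \<notin> ?N"
          by (rule nonzerodivisor_not_nilpotent[OF a one_nz reg_a])
        then obtain k :: nat and y where y: "y \<in> carrier R" "w [^] k = a \<otimes> y"
          using divides_pow a by blast
        obtain e :: nat and z where z: "z \<in> carrier R" "b [^] e = w \<otimes> z"
          using pow_multiple bM by blast
        interpret A: ideal "Idl {a}" R using a by (intro genideal_ideal) simp
        have "b [^] (e * k) = (b [^] e) [^] k" using b by (simp only: nat_pow_pow)
        also have "\<dots> = w [^] k \<otimes> z [^] k" using z wc by (simp add: nat_pow_distrib)
        also have "\<dots> = a \<otimes> (y \<otimes> z [^] k)" using y z a by (simp add: m_assoc)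
        finally have "b [^] (e * k) \<in> Idl {a}"
          using genideal_self'[OF a] y z A.I_r_closed by simp
        then have "\<one> \<in> Idl {a}" using regular_element_pow[OF A.is_ideal b] reg_b by blast
        then show False using M_genideal[of "{a}"] aM one_nM by auto
      qed
    qed
  qed
  moreover have "\<forall>M'. maximalideal M' R \<longrightarrow> M' = M"
  proof (intro allI impI)
    fix M' assume "maximalideal M' R"
    then interpret M': maximalideal M' R .
    have "\<one> \<notin> M'" using M'.one_imp_carrier M'.I_notcarr by blast
    then have "M' \<subseteq> M" by (rule proper[OF M'.is_ideal])
    then show "M' = M" using M'.I_maximal[OF M.is_ideal] M.a_subset M.I_notcarr by blast
  qed
  ultimately show ?thesis
    unfolding cohen_macaulay_local_def using noetherian max is_cring by metis
qed

end


section \<open>Localization\<close>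

locale multiplicative_subset = cring R for R (structure) +
  fixes S
  assumes S_subset: "S \<subseteq> carrier R" and one_S: "\<one> \<in> S"
    and mult_S: "\<And>s t. s \<in> S \<Longrightarrow> t \<in> S \<Longrightarrow> s \<otimes> t \<in> S"
begin

abbreviation "fraction \<equiv> loc_frac R S"
abbreviation "L \<equiv> localization R S"

lemma S_closed [simp]: "s \<in> S \<Longrightarrow> s \<in> carrier R"
  using S_subset by blast

declare one_S [simp] mult_S [simp]

lemma in_fraction_iff:
  assumes "a \<in> carrier R" "s \<in> S"
  shows "(b, t) \<in> fraction a s \<longleftrightarrow>
    b \<in> carrier R \<and> t \<in> S \<and> (\<exists>u\<in>S. u \<otimes> (t \<otimes> a) = u \<otimes> (s \<otimes> b))"
proof -
  have "u \<otimes> (t \<otimes> a \<ominus> s \<otimes> b) = \<zero> \<longleftrightarrow> u \<otimes> (t \<otimes> a) = u \<otimes> (s \<otimes> b)"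
    if "b \<in> carrier R" "t \<in> S" "u \<in> S" for u
  proof -
    have "u \<otimes> (t \<otimes> a \<ominus> s \<otimes> b) = u \<otimes> (t \<otimes> a) \<ominus> u \<otimes> (s \<otimes> b)"
      using that assms S_closed[of u] S_closed[of t] S_closed[of s] by algebra
    then show ?thesis using that assms by simp
  qed
  then show ?thesis unfolding loc_frac_def by auto
qed

lemma fraction_subset:
  assumes "a \<in> carrier R" "s \<in> S" "b \<in> carrier R" "t \<in> S" "v \<in> S"
    and eq: "v \<otimes> (t \<otimes> a) = v \<otimes> (s \<otimes> b)"
  shows "fraction a s \<subseteq> fraction b t"
proof (clarify)
  fix c r assume "(c, r) \<in> fraction a s"
  then obtain u where c: "c \<in> carrier R" "r \<in> S" "u \<in> S" "u \<otimes> (r \<otimes> a) = u \<otimes> (s \<otimes> c)"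
    using in_fraction_iff assms by auto
  have "(u \<otimes> v \<otimes> s) \<otimes> (r \<otimes> b) = u \<otimes> r \<otimes> (v \<otimes> (s \<otimes> b))"
    using assms(1-5) c(1-3) by (simp add: m_ac)
  also have "\<dots> = u \<otimes> r \<otimes> (v \<otimes> (t \<otimes> a))" using eq by simp
  also have "\<dots> = v \<otimes> t \<otimes> (u \<otimes> (r \<otimes> a))" using assms(1-5) c(1-3) by (simp add: m_ac)
  also have "\<dots> = (u \<otimes> v \<otimes> s) \<otimes> (t \<otimes> c)"
    unfolding c(4) using assms(1-5) c(1-3) by (simp add: m_ac)
  finally show "(c, r) \<in> fraction b t"
    unfolding in_fraction_iff[OF assms(3,4)] using c assms(2,5) by (blast intro: mult_S)
qed

lemma fraction_eqI:
  assumes "a \<in> carrier R" "s \<in> S" "b \<in> carrier R" "t \<in> S" "v \<in> S"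
    and "v \<otimes> (t \<otimes> a) = v \<otimes> (s \<otimes> b)"
  shows "fraction a s = fraction b t"
  using assms fraction_subset[of a s b t v] fraction_subset[of b t a s v] by auto

lemma fraction_eqI_cross:
  assumes "a \<in> carrier R" "s \<in> S" "b \<in> carrier R" "t \<in> S" "t \<otimes> a = s \<otimes> b"
  shows "fraction a s = fraction b t"
  using assms fraction_eqI[of a s b t \<one>] by simp

lemma fraction_self:
  assumes "a \<in> carrier R" "s \<in> S"
  shows "(a, s) \<in> fraction a s"
  using assms in_fraction_iff by (auto intro: bexI[of _ \<one>])

lemma fraction_eq_iff:
  assumes "a \<in> carrier R" "s \<in> S" "b \<in> carrier R" "t \<in> S"
  shows "fraction a s = fraction b t \<longleftrightarrow> (\<exists>u\<in>S. u \<otimes> (t \<otimes> a) = u \<otimes> (s \<otimes> b))"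
  using assms fraction_self[of b t] in_fraction_iff[of a s b t] fraction_eqI[of a s b t] by auto

lemma fraction_in_carrier [simp]:
  assumes "a \<in> carrier R" "s \<in> S"
  shows "fraction a s \<in> carrier L"
  using assms by (auto simp: localization_def)

lemma carrier_localizationE:
  assumes "x \<in> carrier L"
  obtains a s where "a \<in> carrier R" "s \<in> S" "x = fraction a s"
  using assms by (auto simp: localization_def)

text \<open>The operations of the localization are unions over all representatives; this evaluates such a
  union once the result is known not to depend on the representative.\<close>

lemma UN_const: "x \<in> A \<Longrightarrow> (\<And>y. y \<in> A \<Longrightarrow> f y = c) \<Longrightarrow> (\<Union>y\<in>A. f y) = c"
  by auto

lemma mult_fraction [simp]:
  assumes "a \<in> carrier R" "s \<in> S" "b \<in> carrier R" "t \<in> S"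
  shows "fraction a s \<otimes>\<^bsub>L\<^esub> fraction b t = fraction (a \<otimes> b) (s \<otimes> t)"
proof -
  have eq: "fraction (a' \<otimes> b') (s' \<otimes> t') = fraction (a \<otimes> b) (s \<otimes> t)"
    if a': "(a', s') \<in> fraction a s" and b': "(b', t') \<in> fraction b t" for a' s' b' t'
  proof -
    obtain u where u: "a' \<in> carrier R" "s' \<in> S" "u \<in> S" "u \<otimes> (s' \<otimes> a) = u \<otimes> (s \<otimes> a')"
      using a' in_fraction_iff assms by auto
    obtain v where v: "b' \<in> carrier R" "t' \<in> S" "v \<in> S" "v \<otimes> (t' \<otimes> b) = v \<otimes> (t \<otimes> b')"
      using b' in_fraction_iff assms by auto
    have "(u \<otimes> v) \<otimes> ((s \<otimes> t) \<otimes> (a' \<otimes> b')) = (u \<otimes> (s \<otimes> a')) \<otimes> (v \<otimes> (t \<otimes> b'))"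
      using assms u v by (simp add: m_ac)
    also have "\<dots> = (u \<otimes> (s' \<otimes> a)) \<otimes> (v \<otimes> (t' \<otimes> b))" using u v by simp
    also have "\<dots> = (u \<otimes> v) \<otimes> ((s' \<otimes> t') \<otimes> (a \<otimes> b))"
      using assms u(1-3) v(1-3) by (simp add: m_ac)
    finally show ?thesis using assms u v by (intro fraction_eqI[of _ _ _ _ "u \<otimes> v"]) auto
  qed
  have "fraction a s \<otimes>\<^bsub>L\<^esub> fraction b t =
      (\<Union>p\<in>fraction a s. \<Union>q\<in>fraction b t. fraction (fst p \<otimes> fst q) (snd p \<otimes> snd q))"
    by (simp add: localization_def case_prod_beta)
  also have "\<dots> = fraction (a \<otimes> b) (s \<otimes> t)"
    by (rule UN_const[OF fraction_self], use assms in simp_all, rule UN_const[OF fraction_self])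
      (use assms eq in \<open>auto\<close>)
  finally show ?thesis .
qed

lemma add_fraction [simp]:
  assumes "a \<in> carrier R" "s \<in> S" "b \<in> carrier R" "t \<in> S"
  shows "fraction a s \<oplus>\<^bsub>L\<^esub> fraction b t = fraction (a \<otimes> t \<oplus> b \<otimes> s) (s \<otimes> t)"
proof -
  have eq: "fraction (a' \<otimes> t' \<oplus> b' \<otimes> s') (s' \<otimes> t') = fraction (a \<otimes> t \<oplus> b \<otimes> s) (s \<otimes> t)"
    if a': "(a', s') \<in> fraction a s" and b': "(b', t') \<in> fraction b t" for a' s' b' t'
  proof -
    obtain u where u: "a' \<in> carrier R" "s' \<in> S" "u \<in> S" "u \<otimes> (s' \<otimes> a) = u \<otimes> (s \<otimes> a')"
      using a' in_fraction_iff assms by auto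
    obtain v where v: "b' \<in> carrier R" "t' \<in> S" "v \<in> S" "v \<otimes> (t' \<otimes> b) = v \<otimes> (t \<otimes> b')"
      using b' in_fraction_iff assms by auto
    have "(u \<otimes> v) \<otimes> ((s \<otimes> t) \<otimes> (a' \<otimes> t' \<oplus> b' \<otimes> s')) =
        (u \<otimes> (s \<otimes> a')) \<otimes> (v \<otimes> t \<otimes> t') \<oplus> (v \<otimes> (t \<otimes> b')) \<otimes> (u \<otimes> s \<otimes> s')"
      using assms u v by (simp add: m_ac r_distr)
    also have "\<dots> = (u \<otimes> (s' \<otimes> a)) \<otimes> (v \<otimes> t \<otimes> t') \<oplus> (v \<otimes> (t' \<otimes> b)) \<otimes> (u \<otimes> s \<otimes> s')"
      using u v by simp
    also have "\<dots> = (u \<otimes> v) \<otimes> ((s' \<otimes> t') \<otimes> (a \<otimes> t \<oplus> b \<otimes> s))"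
      using assms u(1-3) v(1-3) by (simp add: m_ac r_distr)
    finally show ?thesis using assms u v by (intro fraction_eqI[of _ _ _ _ "u \<otimes> v"]) auto
  qed
  have "fraction a s \<oplus>\<^bsub>L\<^esub> fraction b t =
      (\<Union>p\<in>fraction a s. \<Union>q\<in>fraction b t. fraction (fst p \<otimes> snd q \<oplus> fst q \<otimes> snd p) (snd p \<otimes> snd q))"
    by (simp add: localization_def case_prod_beta)
  also have "\<dots> = fraction (a \<otimes> t \<oplus> b \<otimes> s) (s \<otimes> t)"
    by (rule UN_const[OF fraction_self], use assms in simp_all, rule UN_const[OF fraction_self])
      (use assms eq in \<open>auto\<close>)
  finally show ?thesis .
qed

lemma one_localization: "\<one>\<^bsub>L\<^esub> = fraction \<one> \<one>" and zero_localization: "\<zero>\<^bsub>L\<^esub> = fraction \<zero> \<one>"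
  by (simp_all add: localization_def)

lemma fraction_zero: "s \<in> S \<Longrightarrow> fraction \<zero> s = \<zero>\<^bsub>L\<^esub>"
  unfolding zero_localization by (rule fraction_eqI_cross) auto

lemma fraction_unit: "s \<in> S \<Longrightarrow> fraction s s = \<one>\<^bsub>L\<^esub>"
  unfolding one_localization by (rule fraction_eqI_cross) auto

lemma cring_localization: "cring L"
proof (rule cringI)
  show "abelian_group L"
  proof (rule abelian_groupI)
    fix x y assume "x \<in> carrier L" "y \<in> carrier L"
    then show "x \<oplus>\<^bsub>L\<^esub> y \<in> carrier L" by (elim carrier_localizationE) simp
  next
    show "\<zero>\<^bsub>L\<^esub> \<in> carrier L" by (simp add: zero_localization)
  next
    fix x y z assume "x \<in> carrier L" "y \<in> carrier L" "z \<in> carrier L"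
    then show "x \<oplus>\<^bsub>L\<^esub> y \<oplus>\<^bsub>L\<^esub> z = x \<oplus>\<^bsub>L\<^esub> (y \<oplus>\<^bsub>L\<^esub> z)"
      by (elim carrier_localizationE) (simp add: m_ac l_distr r_distr a_ac)
  next
    fix x y assume "x \<in> carrier L" "y \<in> carrier L"
    then show "x \<oplus>\<^bsub>L\<^esub> y = y \<oplus>\<^bsub>L\<^esub> x"
      by (elim carrier_localizationE) (simp add: m_ac a_ac)
  next
    fix x assume "x \<in> carrier L"
    then show "\<zero>\<^bsub>L\<^esub> \<oplus>\<^bsub>L\<^esub> x = x"
      by (elim carrier_localizationE) (simp add: zero_localization)
  next
    fix x assume "x \<in> carrier L"
    then obtain a s where a: "a \<in> carrier R" "s \<in> S" "x = fraction a s" by (rule carrier_localizationE)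
    have "(\<ominus> a) \<otimes> s \<oplus> a \<otimes> s = \<zero>" using a(1) S_closed[OF a(2)] by algebra
    then have "fraction (\<ominus> a) s \<oplus>\<^bsub>L\<^esub> x = \<zero>\<^bsub>L\<^esub>" using a by (simp add: fraction_zero)
    then show "\<exists>y\<in>carrier L. y \<oplus>\<^bsub>L\<^esub> x = \<zero>\<^bsub>L\<^esub>" using a by (intro bexI[of _ "fraction (\<ominus> a) s"]) auto
  qed
  show "comm_monoid L"
  proof (rule comm_monoidI)
    fix x y assume "x \<in> carrier L" "y \<in> carrier L"
    then show "x \<otimes>\<^bsub>L\<^esub> y \<in> carrier L" by (elim carrier_localizationE) simp
  next
    show "\<one>\<^bsub>L\<^esub> \<in> carrier L" by (simp add: one_localization)
  next
    fix x y z assume "x \<in> carrier L" "y \<in> carrier L" "z \<in> carrier L"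
    then show "x \<otimes>\<^bsub>L\<^esub> y \<otimes>\<^bsub>L\<^esub> z = x \<otimes>\<^bsub>L\<^esub> (y \<otimes>\<^bsub>L\<^esub> z)"
      by (elim carrier_localizationE) (simp add: m_ac)
  next
    fix x assume "x \<in> carrier L"
    then show "\<one>\<^bsub>L\<^esub> \<otimes>\<^bsub>L\<^esub> x = x"
      by (elim carrier_localizationE) (simp add: one_localization)
  next
    fix x y assume "x \<in> carrier L" "y \<in> carrier L"
    then show "x \<otimes>\<^bsub>L\<^esub> y = y \<otimes>\<^bsub>L\<^esub> x"
      by (elim carrier_localizationE) (simp add: m_ac)
  qed
next
  fix x y z assume "x \<in> carrier L" "y \<in> carrier L" "z \<in> carrier L"
  then obtain a s b t c r where el: "a \<in> carrier R" "s \<in> S" "x = fraction a s"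
    "b \<in> carrier R" "t \<in> S" "y = fraction b t" "c \<in> carrier R" "r \<in> S" "z = fraction c r"
    by (elim carrier_localizationE) blast
  then have "r \<otimes> ((a \<otimes> t \<oplus> b \<otimes> s) \<otimes> c) = (a \<otimes> c) \<otimes> (t \<otimes> r) \<oplus> (b \<otimes> c) \<otimes> (s \<otimes> r)"
    by (simp add: l_distr r_distr m_ac)
  moreover have "(s \<otimes> r) \<otimes> (t \<otimes> r) \<otimes> y = (s \<otimes> t \<otimes> r) \<otimes> (r \<otimes> y)" if "y \<in> carrier R" for y
    using el that by (simp add: m_ac)
  ultimately have "(s \<otimes> r) \<otimes> (t \<otimes> r) \<otimes> ((a \<otimes> t \<oplus> b \<otimes> s) \<otimes> c) =
      (s \<otimes> t \<otimes> r) \<otimes> ((a \<otimes> c) \<otimes> (t \<otimes> r) \<oplus> (b \<otimes> c) \<otimes> (s \<otimes> r))"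
    using el by simp
  then have "fraction ((a \<otimes> t \<oplus> b \<otimes> s) \<otimes> c) (s \<otimes> t \<otimes> r) =
      fraction ((a \<otimes> c) \<otimes> (t \<otimes> r) \<oplus> (b \<otimes> c) \<otimes> (s \<otimes> r)) ((s \<otimes> r) \<otimes> (t \<otimes> r))"
    using el by (intro fraction_eqI_cross) auto
  then show "(x \<oplus>\<^bsub>L\<^esub> y) \<otimes>\<^bsub>L\<^esub> z = x \<otimes>\<^bsub>L\<^esub> z \<oplus>\<^bsub>L\<^esub> y \<otimes>\<^bsub>L\<^esub> z"
    using el by simp
qed

sublocale loc: cring L by (rule cring_localization)

lemma pow_fraction:
  assumes "a \<in> carrier R" "s \<in> S"
  shows "fraction a s [^]\<^bsub>L\<^esub> (m::nat) = fraction (a [^] m) (s [^] m) \<and> s [^] m \<in> S"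
  using assms by (induction m) (auto simp: one_localization)

lemma fraction_split:
  assumes "a \<in> carrier R" "s \<in> S"
  shows "fraction a s = fraction \<one> s \<otimes>\<^bsub>L\<^esub> fraction a \<one>" "fraction a \<one> = fraction s \<one> \<otimes>\<^bsub>L\<^esub> fraction a s"
  using assms by (simp, simp, intro fraction_eqI_cross, auto)

lemma fraction_hom: "ring_hom_ring R L (\<lambda>a. fraction a \<one>)"
  by (rule ring_hom_ringI2) 
    (auto simp: ring_axioms loc.ring_axioms one_localization intro!: ring_hom_memI)

text \<open>Every ideal of the localization is generated by its contraction: \<open>a / s\<close> and \<open>a / 1\<close> are
  multiples of each other.\<close>

lemma noetherian_localization:
  assumes "noetherian_ring R"
  shows "noetherian_ring L"
proof (rule loc.noetherian_ringI)
  fix J assume "ideal J L"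
  then interpret J: ideal J L .
  define I where "I = {a \<in> carrier R. fraction a \<one> \<in> J}"
  have "ideal I R"
    unfolding I_def by (rule ring_hom_ring.ideal_vimage[OF fraction_hom J.is_ideal])
  then obtain A where A: "A \<subseteq> carrier R" "finite A" "I = Idl A"
    using noetherian_ring.finetely_gen[OF assms] by blast
  define B where "B = (\<lambda>a. fraction a \<one>) ` A"
  have B: "B \<subseteq> carrier L" using A by (auto simp: B_def)
  then interpret B: ideal "Idl\<^bsub>L\<^esub> B" L by (rule loc.genideal_ideal)
  have "A \<subseteq> I" using A genideal_self by blast
  then have "B \<subseteq> J" by (auto simp: B_def I_def)
  then have BJ: "Idl\<^bsub>L\<^esub> B \<subseteq> J" by (rule loc.genideal_minimal[OF J.is_ideal])
  have "ideal {a \<in> carrier R. fraction a \<one> \<in> Idl\<^bsub>L\<^esub> B} R"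
    by (rule ring_hom_ring.ideal_vimage[OF fraction_hom B.is_ideal])
  moreover have "A \<subseteq> {a \<in> carrier R. fraction a \<one> \<in> Idl\<^bsub>L\<^esub> B}"
    using A loc.genideal_self[OF B] by (auto simp: B_def)
  ultimately have "I \<subseteq> {a \<in> carrier R. fraction a \<one> \<in> Idl\<^bsub>L\<^esub> B}"
    unfolding A(3) by (rule genideal_minimal)
  have "J \<subseteq> Idl\<^bsub>L\<^esub> B"
  proof
    fix x assume x: "x \<in> J"
    then obtain a s where a: "a \<in> carrier R" "s \<in> S" "x = fraction a s"
      using J.a_subset carrier_localizationE by blast
    have "fraction s \<one> \<otimes>\<^bsub>L\<^esub> x \<in> J" 
      by (rule J.I_l_closed[OF x fraction_in_carrier[OF S_closed[OF a(2)] one_S]])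
    then have "fraction a \<one> \<in> J" by (simp only: fraction_split(2)[OF a(1,2)] a(3))
    then have "fraction a \<one> \<in> Idl\<^bsub>L\<^esub> B" using \<open>I \<subseteq> _\<close> a by (auto simp: I_def)
    then have "fraction \<one> s \<otimes>\<^bsub>L\<^esub> fraction a \<one> \<in> Idl\<^bsub>L\<^esub> B"
      by (rule B.I_l_closed) (use a in simp)
    then show "x \<in> Idl\<^bsub>L\<^esub> B" by (simp only: fraction_split(1)[OF a(1,2)] a(3))
  qed
  then show "\<exists>A\<subseteq>carrier L. finite A \<and> J = Idl\<^bsub>L\<^esub> A"
    using B BJ A(2) by (intro exI[of _ B]) (auto simp: B_def)
qed

lemma extension_ideal:
  assumes "ideal I R"
  shows "ideal {fraction a s | a s. a \<in> I \<and> s \<in> S} L" (is "ideal ?J L")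
proof -
  interpret I: ideal I R by fact
  have sub: "?J \<subseteq> carrier L" by auto
  have mem: "fraction a s \<in> ?J" if "a \<in> I" "s \<in> S" for a s using that by blast
  have l: "x \<otimes>\<^bsub>L\<^esub> y \<in> ?J" if x: "x \<in> carrier L" and y: "y \<in> ?J" for x y
  proof -
    obtain a s b t where el: "a \<in> carrier R" "s \<in> S" "x = fraction a s"
      "b \<in> I" "t \<in> S" "y = fraction b t"
      using x y by (auto elim: carrier_localizationE)
    then have "x \<otimes>\<^bsub>L\<^esub> y = fraction (a \<otimes> b) (s \<otimes> t)" using I.Icarr by simp
    then show ?thesis using mem[of "a \<otimes> b" "s \<otimes> t"] el I.I_l_closed[of b a] by simp
  qed
  show ?thesis
  proof (rule idealI)
    show "ring L" by (rule loc.ring_axioms)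
    show xy: "x \<otimes>\<^bsub>L\<^esub> y \<in> ?J" if "y \<in> ?J" "x \<in> carrier L" for x y
      by (rule l[OF that(2,1)])
    show "y \<otimes>\<^bsub>L\<^esub> x \<in> ?J" if "y \<in> ?J" "x \<in> carrier L" for x y
      unfolding loc.m_comm[OF subsetD[OF sub that(1)] that(2)] by (rule xy[OF that])
    show "subgroup ?J (add_monoid L)"
    proof (rule loc.add.subgroupI)
      show "?J \<subseteq> carrier L" by (rule sub)
      show "?J \<noteq> {}" using I.zero_closed one_S by blast
      show "\<ominus>\<^bsub>L\<^esub> x \<in> ?J" if x: "x \<in> ?J" for x
      proof -
        have xc: "x \<in> carrier L" using x sub by blast
        then have "\<ominus>\<^bsub>L\<^esub> x = (\<ominus>\<^bsub>L\<^esub> \<one>\<^bsub>L\<^esub>) \<otimes>\<^bsub>L\<^esub> x" by (simp add: loc.l_minus)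
        then show ?thesis using l[OF _ x, of "\<ominus>\<^bsub>L\<^esub> \<one>\<^bsub>L\<^esub>"] by simp
      qed
      show "x \<oplus>\<^bsub>L\<^esub> y \<in> ?J" if xy: "x \<in> ?J" "y \<in> ?J" for x y
      proof -
        obtain a s b t where el: "a \<in> I" "s \<in> S" "x = fraction a s"
          "b \<in> I" "t \<in> S" "y = fraction b t"
          using xy by blast
        then have "x \<oplus>\<^bsub>L\<^esub> y = fraction (a \<otimes> t \<oplus> b \<otimes> s) (s \<otimes> t)" using I.Icarr by simp
        moreover have "a \<otimes> t \<oplus> b \<otimes> s \<in> I" using el I.I_r_closed I.a_closed by simp
        ultimately show ?thesis using mem[of "a \<otimes> t \<oplus> b \<otimes> s" "s \<otimes> t"] el by simp
      qed
    qed
  qed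
qed

end


section \<open>Algebras over a polynomial ring\<close>

lemma poly_ideal_principal:
  fixes J :: "'k::field poly set"
  assumes "0 \<in> J" and add: "\<And>f g. f \<in> J \<Longrightarrow> g \<in> J \<Longrightarrow> f + g \<in> J"
    and mult: "\<And>f g. f \<in> J \<Longrightarrow> g * f \<in> J"
  shows "\<exists>p\<in>J. \<forall>f\<in>J. p dvd f"
proof (cases "J \<subseteq> {0}")
  case True
  then show ?thesis using assms(1) by (intro bexI[of _ 0]) auto
next
  case False
  then obtain q where "q \<in> J \<and> q \<noteq> 0" by blast
  then obtain p where p: "p \<in> J" "p \<noteq> 0" and min: "\<And>f. f \<in> J \<Longrightarrow> f \<noteq> 0 \<Longrightarrow> degree p \<le> degree f"
    using arg_min_nat_lemma[of "\<lambda>f. f \<in> J \<and> f \<noteq> 0" q degree] by blast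
  show ?thesis
  proof (intro bexI ballI)
    fix f assume "f \<in> J"
    have "f mod p = f + (- (f div p)) * p" by (simp add: minus_div_mult_eq_mod[symmetric])
    then have "f mod p \<in> J" using add mult \<open>f \<in> J\<close> p(1) by metis
    then have "f mod p = 0" using min degree_mod_less[OF p(2), of f] by fastforce
    then show "p dvd f" by (simp add: mod_eq_0_iff_dvd)
  qed (rule p(1))
qed

text \<open>Algebras over a polynomial ring, given by their structure map. The coefficients form a type,
  whereas the algebra is a ring with a carrier.\<close>

locale poly_algebra = cring R for R (structure) +
  fixes \<phi> :: "'k::field poly \<Rightarrow> 'a"
  assumes phi_closed [simp]: "\<phi> f \<in> carrier R"
    and phi_add: "\<phi> (f + g) = \<phi> f \<oplus> \<phi> g"
    and phi_mult: "\<phi> (f * g) = \<phi> f \<otimes> \<phi> g"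
    and phi_one: "\<phi> 1 = \<one>"
begin

lemma phi_zero: "\<phi> 0 = \<zero>"
  using phi_add[of 0 0] phi_closed[of 0] by (metis add.r_cancel_one' add_0)

lemma phi_pow: "\<phi> (f ^ m) = \<phi> f [^] m"
  by (induction m) (simp_all add: phi_one phi_mult m_comm)

primrec poly_span :: "'a list \<Rightarrow> 'a set" where
  "poly_span [] = {\<zero>}"
| "poly_span (e # es) = {\<phi> f \<otimes> e \<oplus> h | f h. h \<in> poly_span es}"

lemma poly_span_ConsI:
  "x = \<phi> f \<otimes> e \<oplus> h \<Longrightarrow> h \<in> poly_span es \<Longrightarrow> x \<in> poly_span (e # es)"
  by auto

definition submodule :: "'a set \<Rightarrow> bool" where
  "submodule W \<longleftrightarrow> W \<subseteq> carrier R \<and> \<zero> \<in> W \<and> (\<forall>x\<in>W. \<forall>y\<in>W. x \<oplus> y \<in> W) \<and>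
     (\<forall>x\<in>W. \<forall>f. \<phi> f \<otimes> x \<in> W)"

lemma submoduleD:
  assumes "submodule W"
  shows "W \<subseteq> carrier R" "\<zero> \<in> W" "x \<in> W \<Longrightarrow> y \<in> W \<Longrightarrow> x \<oplus> y \<in> W"
    "x \<in> W \<Longrightarrow> \<phi> f \<otimes> x \<in> W"
  using assms unfolding submodule_def by blast+

lemma poly_span_submodule: "set es \<subseteq> carrier R \<Longrightarrow> submodule (poly_span es)"
proof (induction es)
  case (Cons e es)
  note [simp] = Cons.prems[simplified]
  have W: "submodule (poly_span es)" using Cons by simp
  note sub = submoduleD(1)[OF W]
  show ?case
    unfolding submodule_def
  proof (intro conjI ballI allI)
    show "poly_span (e # es) \<subseteq> carrier R" using sub by auto
    have "\<zero> = \<phi> 0 \<otimes> e \<oplus> \<zero>" by (simp add: phi_zero)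
    then show "\<zero> \<in> poly_span (e # es)" by (rule poly_span_ConsI[OF _ submoduleD(2)[OF W]])
  next
    fix x y assume "x \<in> poly_span (e # es)" "y \<in> poly_span (e # es)"
    then obtain f h g k where fh: "x = \<phi> f \<otimes> e \<oplus> h" "h \<in> poly_span es"
      "y = \<phi> g \<otimes> e \<oplus> k" "k \<in> poly_span es" by auto
    then have "x \<oplus> y = \<phi> (f + g) \<otimes> e \<oplus> (h \<oplus> k)"
      using subsetD[OF sub] by (simp add: phi_add l_distr a_ac)
    then show "x \<oplus> y \<in> poly_span (e # es)" using fh submoduleD(3)[OF W] by auto
  next
    fix x g assume "x \<in> poly_span (e # es)"
    then obtain f h where fh: "x = \<phi> f \<otimes> e \<oplus> h" "h \<in> poly_span es" by auto
    then have "\<phi> g \<otimes> x = \<phi> (g * f) \<otimes> e \<oplus> \<phi> g \<otimes> h"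
      using subsetD[OF sub] by (simp add: phi_mult r_distr m_assoc)
    then show "\<phi> g \<otimes> x \<in> poly_span (e # es)" using fh submoduleD(4)[OF W] by auto
  qed
qed (auto simp: submodule_def)

lemma poly_span_subset_submodule:
  assumes "submodule W" "set es \<subseteq> W"
  shows "poly_span es \<subseteq> W"
  using assms(2) submoduleD[OF assms(1)] by (induction es) auto

lemma generator_in_poly_span:
  assumes "set es \<subseteq> carrier R" "e \<in> set es"
  shows "e \<in> poly_span es"
  using assms
proof (induction es)
  case (Cons d es)
  note [simp] = Cons.prems(1)[simplified]
  have W: "submodule (poly_span es)" using Cons poly_span_submodule by simp
  show ?case
  proof (cases "e = d")
    case True
    then have "e = \<phi> 1 \<otimes> d \<oplus> \<zero>" by (simp add: phi_one)
    then show ?thesis by (rule poly_span_ConsI[OF _ submoduleD(2)[OF W]])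
  next
    case False
    then have e: "e \<in> poly_span es" using Cons by auto
    then have "e = \<phi> 0 \<otimes> d \<oplus> e" using submoduleD(1)[OF W] by (auto simp: phi_zero)
    then show ?thesis by (rule poly_span_ConsI[OF _ e])
  qed
qed simp

lemma ideal_submodule:
  assumes "ideal I R"
  shows "submodule I"
proof -
  interpret I: ideal I R by fact
  show ?thesis
    unfolding submodule_def using I.a_subset I.I_l_closed I.zero_closed I.a_closed by auto
qed

text \<open>Submodules of a finitely generated module over a principal ideal ring are finitely generated.
  Induction on the generators: the coefficients of the first generator in elements of \<open>W\<close> form an
  ideal, generated by some \<open>p\<close>. An element \<open>d\<close> of \<open>W\<close> with coefficient \<open>p\<close> then reduces every
  element of \<open>W\<close> to one in the span of the remaining generators.\<close>

lemma submodule_finitely_generated: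
  assumes "submodule W" "set es \<subseteq> carrier R" "W \<subseteq> poly_span es"
  shows "\<exists>ds. set ds \<subseteq> W \<and> W \<subseteq> poly_span ds"
  using assms
proof (induction es arbitrary: W)
  case Nil
  then show ?case by (intro exI[of _ "[]"]) auto
next
  case (Cons e es)
  note [simp] = Cons.prems(2)[simplified]
  note W = submoduleD[OF Cons.prems(1)]
  have Sp: "submodule (poly_span es)" by (rule poly_span_submodule) simp
  note S = submoduleD[OF Sp]
  define J where "J = {f. \<exists>h\<in>poly_span es. \<phi> f \<otimes> e \<oplus> h \<in> W}"
  have "\<exists>p\<in>J. \<forall>f\<in>J. p dvd f"
  proof (rule poly_ideal_principal)
    have "\<phi> 0 \<otimes> e \<oplus> \<zero> \<in> W" using W(2) by (simp add: phi_zero)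
    then show "0 \<in> J" using S(2) unfolding J_def by blast
  next
    fix f g assume "f \<in> J" "g \<in> J"
    then obtain h k where hk: "h \<in> poly_span es" "\<phi> f \<otimes> e \<oplus> h \<in> W"
      "k \<in> poly_span es" "\<phi> g \<otimes> e \<oplus> k \<in> W" unfolding J_def by blast
    then have "(\<phi> f \<otimes> e \<oplus> h) \<oplus> (\<phi> g \<otimes> e \<oplus> k) = \<phi> (f + g) \<otimes> e \<oplus> (h \<oplus> k)"
      using subsetD[OF S(1)] by (simp add: phi_add l_distr a_ac)
    then show "f + g \<in> J" using hk S(3) W(3) unfolding J_def by fastforce
  next
    fix f g assume "f \<in> J"
    then obtain h where h: "h \<in> poly_span es" "\<phi> f \<otimes> e \<oplus> h \<in> W" unfolding J_def by blast
    then have "\<phi> g \<otimes> (\<phi> f \<otimes> e \<oplus> h) = \<phi> (g * f) \<otimes> e \<oplus> \<phi> g \<otimes> h"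
      using subsetD[OF S(1)] by (simp add: phi_mult r_distr m_assoc)
    moreover have "\<phi> g \<otimes> (\<phi> f \<otimes> e \<oplus> h) \<in> W" "\<phi> g \<otimes> h \<in> poly_span es"
      using h S(4) W(4) by blast+
    ultimately show "g * f \<in> J" unfolding J_def by auto
  qed
  then obtain p where p: "p \<in> J" "\<And>f. f \<in> J \<Longrightarrow> p dvd f" by blast
  then obtain h0 where h0: "h0 \<in> poly_span es" "\<phi> p \<otimes> e \<oplus> h0 \<in> W"
    unfolding J_def by blast
  define d where "d = \<phi> p \<otimes> e \<oplus> h0"
  have "submodule (W \<inter> poly_span es)"
    unfolding submodule_def
    by (intro conjI ballI allI) (use W S in \<open>simp_all add: le_infI1\<close>)
  then obtain ds where ds: "set ds \<subseteq> W \<inter> poly_span es" "W \<inter> poly_span es \<subseteq> poly_span ds"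
    using Cons.IH[of "W \<inter> poly_span es"] by auto
  have "W \<subseteq> poly_span (d # ds)"
  proof
    fix w assume w: "w \<in> W"
    then obtain f h where fh: "w = \<phi> f \<otimes> e \<oplus> h" "h \<in> poly_span es" using Cons.prems(3) by auto
    then have "f \<in> J" using w unfolding J_def by blast
    then obtain g where g: "f = p * g" using p(2) by (auto elim: dvdE)
    note carr = subsetD[OF S(1) fh(2)] subsetD[OF S(1) h0(1)]
    define r where "r = h \<oplus> \<phi> (- g) \<otimes> h0"
    have neg: "\<phi> (- g) = \<ominus> \<phi> g"
      using phi_add[of "- g" g] by (intro minus_equality[symmetric]) (auto simp: phi_zero)
    have "r = w \<oplus> \<phi> (- g) \<otimes> d"
      unfolding r_def fh(1) d_def g using carr Cons.prems(2) phi_closed[of p] phi_closed[of g]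
      by (simp add: phi_mult neg r_distr l_distr m_ac l_minus r_minus a_ac r_neg r_neg2 r_neg1)
    moreover have "r \<in> poly_span es" unfolding r_def by (intro S fh h0)
    ultimately have r: "r \<in> poly_span ds" using ds(2) W w h0(2) by (auto simp: d_def)
    have "w = \<phi> g \<otimes> d \<oplus> r"
      unfolding r_def fh(1) d_def g using carr Cons.prems(2) phi_closed[of p] phi_closed[of g]
      by (simp add: phi_mult neg r_distr l_distr m_ac l_minus r_minus a_ac r_neg r_neg2 r_neg1)
    then show "w \<in> poly_span (d # ds)" using r by auto
  qed
  then show ?case using ds(1) h0(2) by (intro exI[of _ "d # ds"]) (auto simp: d_def)
qed

lemma noetherian_of_finite:
  assumes es: "set es \<subseteq> carrier R" "carrier R \<subseteq> poly_span es"
  shows "noetherian_ring R"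
proof (rule noetherian_ringI)
  fix I assume I: "ideal I R"
  then interpret I: ideal I R .
  obtain ds where ds: "set ds \<subseteq> I" "I \<subseteq> poly_span ds"
    using submodule_finitely_generated[OF ideal_submodule[OF I] es(1)] es(2) I.a_subset by blast
  have dsc: "set ds \<subseteq> carrier R" using ds(1) I.a_subset by blast
  have "poly_span ds \<subseteq> Idl (set ds)"
    by (rule poly_span_subset_submodule[OF ideal_submodule[OF genideal_ideal[OF dsc]] genideal_self[OF dsc]])
  moreover have "Idl (set ds) \<subseteq> I" by (rule genideal_minimal[OF I ds(1)])
  ultimately show "\<exists>A\<subseteq>carrier R. finite A \<and> I = Idl A"
    using ds dsc by (intro exI[of _ "set ds"]) auto
qed

lemma factor_out_powers:
  assumes "f \<noteq> 0" "\<not> is_unit (p :: 'k poly)"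
  shows "\<exists>k h. f = p ^ k * h \<and> \<not> p dvd h"
  using assms(1)
proof (induction "degree f" arbitrary: f rule: less_induct)
  case less
  show ?case
  proof (cases "p dvd f")
    case True
    then obtain g where g: "f = p * g" by (auto elim: dvdE)
    then have nz: "p \<noteq> 0" "g \<noteq> 0" using less.prems by auto
    then have "degree p > 0" using assms(2) is_unit_iff_degree by blast
    then have "degree g < degree f" using g nz by (simp add: degree_mult_eq)
    then obtain k h where "g = p ^ k * h" "\<not> p dvd h" using less.hyps nz by blast
    then show ?thesis using g by (intro exI[of _ "Suc k"] exI[of _ h]) (simp add: mult.assoc)
  next
    case False
    then show ?thesis by (intro exI[of _ 0] exI[of _ f]) simp
  qed
qed

text \<open>The parameter in the localization at a maximal ideal \<open>P\<close> is the generator \<open>p\<close> of the ideal of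
  polynomials that land in \<open>P\<close>. It is nonzero because otherwise \<open>P\<close> would be the nilradical, and
  the quotient by it is the polynomial ring, which is not a field. If \<open>x = f + z\<close> with \<open>f\<close> a
  polynomial and \<open>z\<close> nilpotent, then \<open>x\<close> divides a power of \<open>f\<close>;
  and \<open>f\<close>, if nonzero, is a power of \<open>p\<close> times a polynomial outside \<open>P\<close>, which is a unit after
  localizing. If moreover \<open>x \<in> P\<close>, then \<open>p\<close> divides \<open>f\<close>, which divides a power of \<open>x\<close>.\<close>

theorem cohen_macaulay_of_regular_poly_subring:
  assumes es: "set es \<subseteq> carrier R" "carrier R \<subseteq> poly_span es"
    and regular: "\<And>f y. f \<noteq> 0 \<Longrightarrow> y \<in> carrier R \<Longrightarrow> \<phi> f \<otimes> y = \<zero> \<Longrightarrow> y = \<zero>"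
    and decomp: "\<And>x. x \<in> carrier R \<Longrightarrow> \<exists>f. \<exists>z\<in>nilradical R. x = \<phi> f \<oplus> z"
  shows "cohen_macaulay R"
proof -
  have noeth: "noetherian_ring R" by (rule noetherian_of_finite[OF es])
  interpret N: ideal "nilradical R" R by (rule nilradical_ideal)
  have "cohen_macaulay_local (localization_at_prime R P)" if max: "maximalideal P R" for P
  proof -
    interpret P: maximalideal P R by fact
    have prime: "primeideal P R" by (rule maximalideal_prime[OF max])
    interpret Q: primeideal P R by (rule prime)
    define S where "S = carrier R - P"
    have one_nP: "\<one> \<notin> P" using P.one_imp_carrier P.I_notcarr by blast
    interpret multiplicative_subset R S
      by unfold_locales (use one_nP Q.I_prime in \<open>auto simp: S_def\<close>)
    have NP: "nilradical R \<subseteq> P" by (rule nilradical_subset_prime[OF prime])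
    have "\<exists>p\<in>{f. \<phi> f \<in> P}. \<forall>f\<in>{f. \<phi> f \<in> P}. p dvd f"
      by (rule poly_ideal_principal) (auto simp: phi_zero phi_add phi_mult P.I_l_closed)
    then obtain p where p: "\<phi> p \<in> P" "\<And>f. \<phi> f \<in> P \<Longrightarrow> p dvd f" by blast
    have p_dvd: "\<phi> (p * f) \<in> P" for f using p(1) by (simp add: phi_mult P.I_r_closed)
    have p_unit: "\<not> is_unit p"
      using p_dvd one_nP phi_one by (metis dvdE)
    have p_nz: "p \<noteq> 0"
    proof
      assume "p = 0"
      then have f0: "f = 0" if "\<phi> f \<in> P" for f using p(2)[OF that] by simp
      \<comment> \<open>Maximality makes the variable \<open>X\<close> invertible modulo \<open>P\<close>, say with inverse \<open>f\<close>; then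
        \<open>1 - f X\<close> lands in \<open>P\<close>, although its value at \<open>0\<close> shows that it is not zero.\<close>
      define X :: "'k poly" where "X = [:0, 1:]"
      have X: "\<phi> X \<notin> P" using f0[of X] by (auto simp: X_def)
      interpret I: ideal "P <+>\<^bsub>R\<^esub> PIdl (\<phi> X)" R
        by (rule add_ideals[OF P.is_ideal cgenideal_ideal]) simp
      have sub: "P \<subseteq> P <+>\<^bsub>R\<^esub> PIdl (\<phi> X)" "\<phi> X \<in> P <+>\<^bsub>R\<^esub> PIdl (\<phi> X)"
      proof -
        have z: "\<zero> \<in> PIdl (\<phi> X)" "\<phi> X \<in> PIdl (\<phi> X)"
          using cgenideal_ideal[of "\<phi> X"] cgenideal_self[of "\<phi> X"]
          by (auto intro: additive_subgroup.zero_closed ideal.axioms(1))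
        have "x = x \<oplus> \<zero>" if "x \<in> P" for x using that P.a_subset by auto
        then show "P \<subseteq> P <+>\<^bsub>R\<^esub> PIdl (\<phi> X)" using z(1) unfolding set_add_def' by blast
        have "\<phi> X = \<zero> \<oplus> \<phi> X" by simp
        then show "\<phi> X \<in> P <+>\<^bsub>R\<^esub> PIdl (\<phi> X)" using z(2) P.zero_closed unfolding set_add_def' by blast
      qed
      have "P <+>\<^bsub>R\<^esub> PIdl (\<phi> X) = carrier R"
        using P.I_maximal[OF I.is_ideal sub(1) I.a_subset] sub(2) X by blast
      then have "\<one> \<in> P <+>\<^bsub>R\<^esub> PIdl (\<phi> X)" by simp
      then obtain a y where ay: "a \<in> P" "y \<in> carrier R" "\<one> = a \<oplus> y \<otimes> \<phi> X"
        unfolding set_add_def' cgenideal_def by blast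
      obtain f z where fz: "z \<in> nilradical R" "y = \<phi> f \<oplus> z" using decomp[OF ay(2)] by blast
      have zP: "z \<in> P" using fz(1) NP by blast
      have carr: "a \<in> carrier R" "z \<in> carrier R" using ay(1) zP P.a_subset by auto
      have "\<one> = (a \<oplus> z \<otimes> \<phi> X) \<oplus> \<phi> (f * X)"
        unfolding ay(3) fz(2) using carr by (simp add: phi_mult l_distr a_ac)
      moreover have "a \<oplus> z \<otimes> \<phi> X \<in> P" using ay(1) zP P.I_r_closed P.a_closed by simp
      moreover have "\<phi> (1 - f * X) \<oplus> \<phi> (f * X) = \<one>"
        using phi_add[of "1 - f * X" "f * X"] by (simp add: phi_one)
      ultimately have "\<phi> (1 - f * X) \<in> P" using carr by (metis add.r_cancel phi_closed P.Icarr)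
      then have "1 - f * X = 0" by (rule f0)
      then have "poly (1 - f * X) 0 = 0" by simp
      then show False by (simp add: X_def)
    qed
    define M where "M = {fraction a s | a s. a \<in> P \<and> s \<in> S}"
    have M: "fraction a s \<in> M \<longleftrightarrow> a \<in> P" if as: "a \<in> carrier R" "s \<in> S" for a s
    proof
      assume "fraction a s \<in> M"
      then obtain b t where b: "b \<in> P" "t \<in> S" "fraction a s = fraction b t" by (auto simp: M_def)
      then have bc: "b \<in> carrier R" using P.a_subset by blast
      then obtain u where u: "u \<in> S" "u \<otimes> (t \<otimes> a) = u \<otimes> (s \<otimes> b)"
        using fraction_eq_iff[OF as bc b(2)] b(3) by blast
      then have "u \<otimes> (t \<otimes> a) \<in> P" using b(1) as by (simp add: P.I_l_closed)
      then show "a \<in> P" using Q.I_prime[of u "t \<otimes> a"] Q.I_prime[of t a] u(1) b(2) as by (auto simp: S_def)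
    qed (use as in \<open>auto simp: M_def\<close>)
    interpret M: ideal M L unfolding M_def by (rule extension_ideal[OF P.is_ideal])
    have unit: "x \<in> Units L" if x: "x \<in> carrier L" "x \<notin> M" for x
    proof -
      obtain a s where a: "a \<in> carrier R" "s \<in> S" "x = fraction a s"
        using x(1) by (rule carrier_localizationE)
      then have aS: "a \<in> S" using x(2) M by (simp add: S_def)
      have "fraction s a \<otimes>\<^bsub>L\<^esub> x = \<one>\<^bsub>L\<^esub>" "x \<otimes>\<^bsub>L\<^esub> fraction s a = \<one>\<^bsub>L\<^esub>"
        using a aS by (simp_all add: fraction_unit m_comm[of s a])
      moreover have "fraction s a \<in> carrier L" using a aS by simp
      ultimately show ?thesis using x(1) unfolding Units_def by blast
    qed
    have one_nM: "\<one>\<^bsub>L\<^esub> \<notin> M" using M[of \<one> \<one>] one_nP by (simp add: one_localization)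
    have M_max: "maximalideal M L"
    proof (rule maximalidealI)
      show "ideal M L" by (rule M.is_ideal)
      show "carrier L \<noteq> M" using one_nM loc.one_closed by blast
      fix J assume J: "ideal J L" "M \<subseteq> J" "J \<subseteq> carrier L"
      interpret J: ideal J L by fact
      show "J = M \<or> J = carrier L"
      proof (cases "J = M")
        case False
        then obtain x where x: "x \<in> J" "x \<notin> M" using J(2) by blast
        then have u: "x \<in> Units L" using unit J(3) by blast
        then have "inv\<^bsub>L\<^esub> x \<otimes>\<^bsub>L\<^esub> x \<in> J" using x(1) by (intro J.I_l_closed) auto
        then have "\<one>\<^bsub>L\<^esub> \<in> J" using u by simp
        then show ?thesis using J.one_imp_carrier by blast
      qed simp
    qed
    define w where "w = fraction (\<phi> p) \<one>"
    have w_pow: "w [^]\<^bsub>L\<^esub> (k::nat) = fraction (\<phi> p [^] k) \<one>" for k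
      unfolding w_def using pow_fraction[of "\<phi> p" \<one> k] by simp
    have "cohen_macaulay_local L"
    proof (rule loc.cohen_macaulay_local_of_parameter[OF noetherian_localization[OF noeth] M_max unit])
      show "w \<in> M" using M p(1) by (simp add: w_def)
    next
      fix y assume "y \<in> carrier L" and wy: "w \<otimes>\<^bsub>L\<^esub> y = \<zero>\<^bsub>L\<^esub>"
      then obtain a s where a: "a \<in> carrier R" "s \<in> S" "y = fraction a s"
        by (elim carrier_localizationE)
      have "fraction (\<phi> p \<otimes> a) s = fraction \<zero> \<one>"
        using wy a by (simp add: w_def zero_localization)
      then obtain u where u: "u \<in> S" "u \<otimes> (\<one> \<otimes> (\<phi> p \<otimes> a)) = u \<otimes> (s \<otimes> \<zero>)"
        using fraction_eq_iff[of "\<phi> p \<otimes> a" s \<zero> \<one>] a by auto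
      then have "\<phi> p \<otimes> (u \<otimes> a) = \<zero>" using a by (simp add: m_ac)
      then have "u \<otimes> a = \<zero>" using regular[OF p_nz] a u by simp
      then show "y = \<zero>\<^bsub>L\<^esub>"
        unfolding a(3) zero_localization using a u by (intro fraction_eqI[of _ _ _ _ u]) auto
    next
      fix x assume "x \<in> carrier L" and xN: "x \<notin> nilradical L"
      then obtain a s where a: "a \<in> carrier R" "s \<in> S" "x = fraction a s"
        by (elim carrier_localizationE)
      obtain f z where fz: "z \<in> nilradical R" "a = \<phi> f \<oplus> z" using decomp[OF a(1)] by blast
      have zc: "z \<in> carrier R" by (rule N.Icarr[OF fz(1)])
      have "f \<noteq> 0"
      proof
        assume "f = 0"
        then have "a = z" using fz(2) zc by (simp add: phi_zero)
        then obtain m :: nat where "a [^] m = \<zero>" using fz(1) unfolding nilradical_def by blast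
        then have "x [^]\<^bsub>L\<^esub> m = \<zero>\<^bsub>L\<^esub>" using pow_fraction[OF a(1,2), of m] a(3) fraction_zero by simp
        then show False using xN \<open>x \<in> carrier L\<close> unfolding nilradical_def by blast
      qed
      then obtain k h where kh: "f = p ^ k * h" "\<not> p dvd h" using factor_out_powers p_unit by blast
      have hS: "\<phi> h \<in> S" using kh(2) p(2) by (auto simp: S_def)
      have "\<ominus> z \<in> nilradical R" using fz(1) by simp
      then obtain m :: nat where m: "(\<ominus> z) [^] m = \<zero>" unfolding nilradical_def by blast
      obtain b where b: "b \<in> carrier R" "(a \<oplus> \<ominus> z) [^] m = a \<otimes> b \<oplus> (\<ominus> z) [^] m"
        using add_pow_eq_mult_add_pow[of a "\<ominus> z" m] a(1) zc by auto
      have "a \<oplus> \<ominus> z = \<phi> f" unfolding fz(2) using zc by (simp add: a_assoc r_neg)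
      then have "\<phi> f [^] m = a \<otimes> b" using b m a by simp
      moreover have "\<phi> f [^] m = \<phi> p [^] (k * m) \<otimes> \<phi> h [^] m"
        unfolding kh(1) by (simp add: phi_mult phi_pow nat_pow_distrib nat_pow_pow)
      ultimately have eq: "\<phi> p [^] (k * m) \<otimes> \<phi> h [^] m = a \<otimes> b" by simp
      have hmS: "\<phi> h [^] m \<in> S" using pow_fraction[of \<one> "\<phi> h" m] hS by simp
      have "(s \<otimes> \<phi> h [^] m) \<otimes> \<phi> p [^] (k * m) = s \<otimes> (\<phi> p [^] (k * m) \<otimes> \<phi> h [^] m)"
        using a(2) by (simp add: m_ac)
      also have "\<dots> = \<one> \<otimes> (a \<otimes> (b \<otimes> s))" unfolding eq using a(1,2) b(1) by (simp add: m_ac)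
      finally have "fraction (\<phi> p [^] (k * m)) \<one> = fraction (a \<otimes> (b \<otimes> s)) (s \<otimes> \<phi> h [^] m)"
        using a(1,2) b(1) hmS by (intro fraction_eqI_cross) auto
      then have "w [^]\<^bsub>L\<^esub> (k * m) = x \<otimes>\<^bsub>L\<^esub> fraction (b \<otimes> s) (\<phi> h [^] m)"
        unfolding w_pow a(3) using a(1,2) b(1) hmS by simp
      then show "\<exists>k::nat. \<exists>y\<in>carrier L. w [^]\<^bsub>L\<^esub> k = x \<otimes>\<^bsub>L\<^esub> y"
        using a(2) b(1) hmS by (intro exI[of _ "k * m"] bexI[of _ "fraction (b \<otimes> s) (\<phi> h [^] m)"]) auto
    next
      fix x assume "x \<in> M"
      then obtain a s where a: "a \<in> P" "s \<in> S" "x = fraction a s" by (auto simp: M_def)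
      have ac: "a \<in> carrier R" using a(1) P.a_subset by blast
      obtain f z where fz: "z \<in> nilradical R" "a = \<phi> f \<oplus> z" using decomp[OF ac] by blast
      have zP: "z \<in> P" using fz(1) NP by blast
      have zc: "z \<in> carrier R" using zP P.a_subset by blast
      obtain m :: nat where m: "z [^] m = \<zero>" using fz(1) unfolding nilradical_def by blast
      have "a \<oplus> \<ominus> z = \<phi> f" unfolding fz(2) using zc by (simp add: a_assoc r_neg)
      moreover have "a \<oplus> \<ominus> z \<in> P" using a(1) zP by simp
      ultimately obtain g where g: "f = p * g" using p(2) by (auto elim: dvdE)
      obtain b where b: "b \<in> carrier R" "a [^] m = \<phi> f \<otimes> b \<oplus> z [^] m"
        using add_pow_eq_mult_add_pow[of "\<phi> f" z m] fz(2) zc by auto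
      then have eq: "a [^] m = \<phi> p \<otimes> (\<phi> g \<otimes> b)" using m by (simp add: g phi_mult m_assoc)
      have sm: "x [^]\<^bsub>L\<^esub> m = fraction (a [^] m) (s [^] m)" "s [^] m \<in> S"
        using pow_fraction[OF ac a(2), of m] a(3) by auto
      then have "x [^]\<^bsub>L\<^esub> m = w \<otimes>\<^bsub>L\<^esub> fraction (\<phi> g \<otimes> b) (s [^] m)"
        using b(1) by (simp add: eq w_def)
      then show "\<exists>e::nat. \<exists>y\<in>carrier L. x [^]\<^bsub>L\<^esub> e = w \<otimes>\<^bsub>L\<^esub> y"
        using b(1) sm(2) by (intro exI[of _ m] bexI[of _ "fraction (\<phi> g \<otimes> b) (s [^] m)"]) auto
    qed
    then show ?thesis by (simp add: localization_at_prime_def S_def)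
  qed
  then show ?thesis unfolding cohen_macaulay_def using noeth is_cring by blast
qed

end


section \<open>Semigroup rings whose maximal ideal powers are given by the order\<close>

text \<open>The hypothesis \<open>split_generator\<close> allows \<open>r\<close> generators to be split off one by one from any
  semigroup element \<open>s \<ge> r a\<close>. As \<open>a\<close> is the smallest generator, it expresses that the longest
  factorization of \<open>s\<close> has length \<open>s div a\<close>.\<close>

locale order_filtered_semigroup_ring =
  fixes A :: "nat set" and a :: nat and R :: "'k::field fps ring"
  assumes finite_A: "finite A" and a_in: "a \<in> A" and a_pos: "0 < a"
    and a_min: "\<And>b. b \<in> A \<Longrightarrow> a \<le> b"
    and split_generator: "\<And>s r. s \<in> semigroup_generated_by A \<Longrightarrow> Suc r * a \<le> s \<Longrightarrow>
          \<exists>b\<in>A. b \<le> s \<and> s - b \<in> semigroup_generated_by A \<and> r * a \<le> s - b"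
    and R_def: "R = semigroup_ring A"
begin

abbreviation "\<Gamma> \<equiv> semigroup_generated_by A"

lemma zero_notin_A: "0 \<notin> A"
  using a_min a_pos by fastforce

sublocale cring R
  unfolding R_def by (rule cring_semigroup_ring[OF finite_A zero_notin_A])

lemma R_simps [simp]: "x \<otimes>\<^bsub>R\<^esub> y = x * y" "x \<oplus>\<^bsub>R\<^esub> y = x + y" "\<one>\<^bsub>R\<^esub> = 1" "\<zero>\<^bsub>R\<^esub> = 0"
  by (simp_all add: R_def semigroup_ring_def)

lemma ideal_sum_closed:
  assumes "ideal I R" "\<And>i. i \<in> T \<Longrightarrow> f i \<in> I"
  shows "sum f T \<in> I"
proof -
  interpret I: ideal I R by fact
  show ?thesis
    using assms(2) I.zero_closed I.a_closed by (induction T rule: infinite_finite_induct) auto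
qed

definition filt :: "nat \<Rightarrow> 'k fps set" where
  "filt r = {f. \<forall>s. fps_nth f s \<noteq> 0 \<longrightarrow> s \<in> \<Gamma> \<and> r * a \<le> s}"

lemma filtI: "(\<And>s. fps_nth f s \<noteq> 0 \<Longrightarrow> s \<in> \<Gamma> \<and> r * a \<le> s) \<Longrightarrow> f \<in> filt r"
  by (simp add: filt_def)

lemma filtD: "f \<in> filt r \<Longrightarrow> fps_nth f s \<noteq> 0 \<Longrightarrow> s \<in> \<Gamma> \<and> r * a \<le> s"
  by (simp add: filt_def)

lemma carrier_R: "carrier R = filt 0"
  unfolding R_def carrier_semigroup_ring[OF finite_A zero_notin_A] by (simp add: filt_def)

lemma filt_antimono: "r \<le> r' \<Longrightarrow> f \<in> filt r' \<Longrightarrow> f \<in> filt r"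
  by (meson filtI filtD le_trans mult_le_mono1)

lemma filt_carrier: "f \<in> filt r \<Longrightarrow> f \<in> carrier R"
  unfolding carrier_R by (rule filt_antimono[of 0 r]) simp

lemma filt_zero [simp]: "0 \<in> filt r"
  by (simp add: filt_def)

lemma filt_one: "1 \<in> filt 0"
  using zero_in_semigroup_generated_by by (auto intro!: filtI split: if_splits)

lemma filt_add: "f \<in> filt r \<Longrightarrow> g \<in> filt r \<Longrightarrow> f + g \<in> filt r"
  by (rule filtI) (metis filtD add.right_neutral fps_add_nth)

lemma filt_uminus: "f \<in> filt r \<Longrightarrow> - f \<in> filt r"
  by (simp add: filt_def)

lemma filt_diff: "f \<in> filt r \<Longrightarrow> g \<in> filt r \<Longrightarrow> f - g \<in> filt r"
  using filt_add[of f r "- g"] filt_uminus[of g] by simp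

lemma filt_sum: "(\<And>i. i \<in> T \<Longrightarrow> f i \<in> filt r) \<Longrightarrow> sum f T \<in> filt r"
  by (induction T rule: infinite_finite_induct) (auto intro: filt_add)

lemma fps_mult_nth_nonzeroE:
  fixes f g :: "'b::semiring_0 fps"
  assumes "fps_nth (f * g) n \<noteq> 0"
  obtains i j where "n = i + j" "fps_nth f i \<noteq> 0" "fps_nth g j \<noteq> 0"
proof -
  have "(\<Sum>i=0..n. fps_nth f i * fps_nth g (n - i)) \<noteq> 0" using assms by (simp add: fps_mult_nth)
  then obtain i where i: "i \<in> {0..n}" "fps_nth f i * fps_nth g (n - i) \<noteq> 0"
    by (rule sum.not_neutral_contains_not_neutral)
  then show thesis using that[of i "n - i"] by fastforce
qed

lemma filt_mult:
  assumes "f \<in> filt r" "g \<in> filt q"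
  shows "f * g \<in> filt (r + q)"
proof (rule filtI)
  fix s assume "fps_nth (f * g) s \<noteq> 0"
  then obtain i j where "s = i + j" "fps_nth f i \<noteq> 0" "fps_nth g j \<noteq> 0"
    by (rule fps_mult_nth_nonzeroE)
  then show "s \<in> \<Gamma> \<and> (r + q) * a \<le> s"
    using filtD[OF assms(1)] filtD[OF assms(2)]
    by (auto simp: add_mult_distrib intro: semigroup_generated_by_add add_mono)
qed

lemma filt_X_pow: "s \<in> \<Gamma> \<Longrightarrow> r * a \<le> s \<Longrightarrow> fps_X ^ s \<in> filt r"
  by (rule filtI) (auto simp: fps_X_power_iff split: if_splits)

lemma filt_const_mult: "f \<in> filt r \<Longrightarrow> fps_const c * f \<in> filt r"
  by (simp add: filt_def)

lemma R_uminus: "f \<in> carrier R \<Longrightarrow> \<ominus>\<^bsub>R\<^esub> f = - f"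
  using filt_uminus[of f 0] by (intro minus_equality) (auto simp: carrier_R)

lemma R_minus: "f \<in> carrier R \<Longrightarrow> g \<in> carrier R \<Longrightarrow> f \<ominus>\<^bsub>R\<^esub> g = f - g"
  by (simp add: a_minus_def R_uminus)

lemma filt_ideal: "ideal (filt r) R"
proof (rule idealI)
  show "ring R" by (rule ring_axioms)
  show "subgroup (filt r) (add_monoid R)"
    by (rule add.subgroupI) (auto simp: filt_carrier R_uminus intro: filt_uminus filt_add filt_zero)
  show "x \<otimes>\<^bsub>R\<^esub> f \<in> filt r" "f \<otimes>\<^bsub>R\<^esub> x \<in> filt r" if "f \<in> filt r" "x \<in> carrier R" for f x
    using that filt_mult[of x 0 f r] filt_mult[of f r x 0] by (auto simp: carrier_R)
qed

text \<open>Each exponent \<open>s\<close> of \<open>f\<close> is assigned to one generator \<open>\<beta> s\<close> that can be split off; collecting the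
  terms with the same \<open>\<beta> s\<close> works for infinite supports as well.\<close>

lemma filt_Suc_decomposition:
  assumes f: "f \<in> filt (Suc r)"
  shows "\<exists>g. (\<forall>b\<in>A. g b \<in> filt r) \<and> f = (\<Sum>b\<in>A. g b * fps_X ^ b)"
proof -
  have "\<exists>\<beta>. \<forall>s. fps_nth f s \<noteq> 0 \<longrightarrow> \<beta> s \<in> A \<and> \<beta> s \<le> s \<and> s - \<beta> s \<in> \<Gamma> \<and> r * a \<le> s - \<beta> s"
    using split_generator filtD[OF f] by (intro choice) blast
  then obtain \<beta> where \<beta>: "\<And>s. fps_nth f s \<noteq> 0 \<Longrightarrow>
      \<beta> s \<in> A \<and> \<beta> s \<le> s \<and> s - \<beta> s \<in> \<Gamma> \<and> r * a \<le> s - \<beta> s" by blast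
  define g where "g b = Abs_fps (\<lambda>j. if \<beta> (j + b) = b then fps_nth f (j + b) else 0)" for b
  have "\<forall>b\<in>A. g b \<in> filt r"
    using \<beta> by (intro ballI filtI) (fastforce simp: g_def split: if_splits)
  moreover have "f = (\<Sum>b\<in>A. g b * fps_X ^ b)"
  proof (rule fps_ext)
    fix s
    have "fps_nth (\<Sum>b\<in>A. g b * fps_X ^ b) s = (\<Sum>b\<in>A. if b = \<beta> s then fps_nth f s else 0)"
      unfolding fps_sum_nth
      by (cases "fps_nth f s = 0"; rule sum.cong)
        (use \<beta>[of s] in \<open>auto simp: fps_X_power_mult_right_nth g_def\<close>)
    also have "\<dots> = (if \<beta> s \<in> A then fps_nth f s else 0)" using finite_A by simp
    also have "\<dots> = fps_nth f s" using \<beta>[of s] by auto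
    finally show "fps_nth f s = fps_nth (\<Sum>b\<in>A. g b * fps_X ^ b) s" ..
  qed
  ultimately show ?thesis by blast
qed

lemma X_pow_generator: "b \<in> A \<Longrightarrow> fps_X ^ b \<in> filt (Suc 0)"
  using a_min generator_in_semigroup_generated_by[OF finite_A] by (intro filt_X_pow) auto

lemma max_ideal_eq_filt: "semigroup_max_ideal A = filt (Suc 0)"
proof -
  let ?X = "(\<lambda>b. fps_X ^ b) ` A :: 'k fps set"
  have X: "?X \<subseteq> filt (Suc 0)" using X_pow_generator by blast
  then have Xc: "?X \<subseteq> carrier R" using filt_carrier by blast
  interpret I: ideal "Idl\<^bsub>R\<^esub> ?X" R by (rule genideal_ideal[OF Xc])
  have "filt (Suc 0) \<subseteq> Idl\<^bsub>R\<^esub> ?X"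
  proof
    fix f assume "f \<in> filt (Suc 0)"
    then obtain g where g: "\<forall>b\<in>A. g b \<in> filt 0" "f = (\<Sum>b\<in>A. g b * fps_X ^ b)"
      using filt_Suc_decomposition[of f 0] by auto
    have "g b * fps_X ^ b \<in> Idl\<^bsub>R\<^esub> ?X" if "b \<in> A" for b
      using I.I_l_closed[of "fps_X ^ b" "g b"] genideal_self[OF Xc] g(1) that by (auto simp: carrier_R)
    then show "f \<in> Idl\<^bsub>R\<^esub> ?X" unfolding g(2) by (rule ideal_sum_closed[OF I.is_ideal])
  qed
  then show ?thesis
    using genideal_minimal[OF filt_ideal X] by (simp add: semigroup_max_ideal_def R_def)
qed

lemma ideal_power_eq_filt: "ideal_power R (filt (Suc 0)) n = filt n"
proof (induction n)
  case 0
  then show ?case by (simp add: carrier_R)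
next
  case (Suc n)
  have "ideal_prod R (filt n) (filt (Suc 0)) = filt (Suc n)"
  proof (intro equalityI subsetI)
    fix f assume "f \<in> ideal_prod R (filt n) (filt (Suc 0))"
    then show "f \<in> filt (Suc n)"
      by induction (use filt_mult filt_add in fastforce)+
  next
    fix f assume "f \<in> filt (Suc n)"
    then obtain g where g: "\<forall>b\<in>A. g b \<in> filt n" "f = (\<Sum>b\<in>A. g b * fps_X ^ b)"
      using filt_Suc_decomposition[of f n] by auto
    have mem: "g b * fps_X ^ b \<in> ideal_prod R (filt n) (filt (Suc 0))" if "b \<in> A" for b
      using ideal_prod.prod[of "g b" "filt n" "fps_X ^ b" "filt (Suc 0)" R] g(1) X_pow_generator that by simp
    interpret I: ideal "ideal_prod R (filt n) (filt (Suc 0))" R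
      by (rule ideal_prod_is_ideal[OF filt_ideal filt_ideal])
    show "f \<in> ideal_prod R (filt n) (filt (Suc 0))"
      unfolding g(2) by (rule ideal_sum_closed[OF I.is_ideal mem])
  qed
  then show ?case using Suc by simp
qed

abbreviation coset :: "nat \<Rightarrow> 'k fps \<Rightarrow> 'k fps set" where
  "coset n f \<equiv> filt (Suc n) +>\<^bsub>R\<^esub> f"

lemma coset_eq_iff:
  assumes "f \<in> carrier R" "g \<in> carrier R"
  shows "coset n f = coset n g \<longleftrightarrow> f - g \<in> filt (Suc n)"
  using quotient_eq_iff_same_a_r_cos[OF filt_ideal assms] R_minus[OF assms] by simp

lemma coset_zero: "coset n 0 = filt (Suc n)"
  by (rule a_rcos_zero[OF filt_ideal filt_zero])

lemma in_cosetE: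
  assumes "y \<in> coset n f"
  obtains h where "h \<in> filt (Suc n)" "y = h + f"
  using assms by (auto simp: a_r_coset_def r_coset_def)

lemma coset_self: "f \<in> coset n f"
  by (auto simp: a_r_coset_def r_coset_def intro!: bexI[of _ 0])

lemma coset_add:
  assumes "f \<in> carrier R" "g \<in> carrier R"
  shows "set_add R (coset n f) (coset n g) = coset n (f + g)"
  using ideal.a_rcos_sum[OF filt_ideal assms] by simp

lemma coset_mult:
  assumes f: "f \<in> filt i" and g: "g \<in> filt j" and n: "n = i + j"
  shows "rcoset_mult R (filt (Suc n)) (coset i f) (coset j g) = coset n (f * g)"
proof -
  have eq: "coset n (x * y) = coset n (f * g)" if xy: "x \<in> coset i f" "y \<in> coset j g" for x y
  proof -
    obtain h where h: "h \<in> filt (Suc i)" "x = h + f" using xy(1) by (rule in_cosetE)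
    obtain k where k: "k \<in> filt (Suc j)" "y = k + g" using xy(2) by (rule in_cosetE)
    have kj: "k + g \<in> filt j" using filt_antimono[of j "Suc j" k] k(1) g by (intro filt_add) auto
    have "x * y - f * g = h * (k + g) + f * k" unfolding h(2) k(2) by (simp add: algebra_simps)
    moreover have "h * (k + g) \<in> filt (Suc n)" "f * k \<in> filt (Suc n)"
      using filt_mult[OF h(1) kj] filt_mult[OF f k(1)] by (simp_all add: n)
    ultimately have d: "x * y - f * g \<in> filt (Suc n)" by (simp add: filt_add)
    have fg: "f * g \<in> carrier R" by (rule filt_carrier[OF filt_mult[OF f g]])
    have "(x * y - f * g) + f * g \<in> carrier R"
      using filt_carrier[OF d] fg unfolding carrier_R by (rule filt_add)
    then have "x * y \<in> carrier R" by simp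
    then show ?thesis using coset_eq_iff fg d by simp
  qed
  have "(\<Union>y\<in>coset j g. coset n (x * y)) = coset n (f * g)" if "x \<in> coset i f" for x
    using coset_self[of g j] by (simp add: eq[OF that] cong: SUP_cong) blast
  then show ?thesis unfolding rcoset_mult_def using coset_self[of f i] by simp blast
qed

lemma finsum_cosets:
  assumes "\<And>i. f i \<in> carrier R"
  shows "finsum (R Quot filt (Suc n)) (\<lambda>i. coset n (f i)) {..m::nat} = coset n (\<Sum>i\<le>m. f i)"
proof -
  interpret I: ideal "filt (Suc n)" R by (rule filt_ideal)
  interpret Q: ring "R Quot filt (Suc n)" by (rule I.quotient_is_ring)
  have c: "(\<lambda>i. coset n (f i)) \<in> T \<rightarrow> carrier (R Quot filt (Suc n))" for T
    using a_rcosetsI[OF I.a_subset assms] by (simp add: FactRing_def)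
  have s: "(\<Sum>i\<le>m. f i) \<in> carrier R" for m
    unfolding carrier_R by (rule filt_sum) (use assms in \<open>simp add: carrier_R\<close>)
  show ?thesis
  proof (induction m)
    case 0
    then show ?case using c[of "{0}"] by simp
  next
    case (Suc m)
    then show ?case
      using Q.finsum_Suc[OF c] coset_add[OF assms[of "Suc m"] s[of m]]
      by (simp add: FactRing_def add.commute)
  qed
qed

section \<open>The tangent cone as a quotient of the Rees algebra\<close>

text \<open>The Rees algebra \<open>\<Oplus>n. m\<^sup>n T\<^sup>n\<close> as a subring of the polynomials in \<open>T\<close> over \<open>K[[t]]\<close>, and the
  surjection from it onto the tangent cone. All ring laws of the tangent cone are inherited along
  this map, and computations with cosets become computations with polynomials.\<close>

definition Rees :: "'k fps poly set" where
  "Rees = {p. \<forall>n. coeff p n \<in> filt n}"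

abbreviation "G \<equiv> assoc_graded R (filt (Suc 0))"

definition form :: "'k fps poly \<Rightarrow> nat \<Rightarrow> 'k fps set" where
  "form p n = coset n (coeff p n)"

lemma ReesD: "p \<in> Rees \<Longrightarrow> coeff p n \<in> filt n"
  by (simp add: Rees_def)

lemma Rees_carrier: "p \<in> Rees \<Longrightarrow> coeff p n \<in> carrier R"
  using ReesD filt_carrier by blast

lemma Rees_add: "p \<in> Rees \<Longrightarrow> q \<in> Rees \<Longrightarrow> p + q \<in> Rees"
  by (simp add: Rees_def filt_add)

lemma Rees_uminus: "p \<in> Rees \<Longrightarrow> - p \<in> Rees"
  by (simp add: Rees_def filt_uminus)

lemma Rees_diff: "p \<in> Rees \<Longrightarrow> q \<in> Rees \<Longrightarrow> p - q \<in> Rees"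
  by (simp add: Rees_def filt_diff)

lemma Rees_zero: "0 \<in> Rees" and Rees_one: "1 \<in> Rees"
  by (simp_all add: Rees_def filt_one)

lemma Rees_mult:
  assumes "p \<in> Rees" "q \<in> Rees"
  shows "p * q \<in> Rees"
  unfolding Rees_def
proof (clarify, unfold coeff_mult, rule filt_sum)
  fix n i :: nat assume "i \<in> {..n}"
  then show "coeff p i * coeff q (n - i) \<in> filt n"
    using filt_mult[OF ReesD[OF assms(1), of i] ReesD[OF assms(2), of "n - i"]] by simp
qed

lemma Rees_monom: "f \<in> filt n \<Longrightarrow> monom f n \<in> Rees"
  by (simp add: Rees_def)

lemma Rees_sum: "(\<And>i. i \<in> T \<Longrightarrow> f i \<in> Rees) \<Longrightarrow> sum f T \<in> Rees"
  by (induction T rule: infinite_finite_induct) (auto intro: Rees_add Rees_zero)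

lemma G_simps:
  "\<zero>\<^bsub>G\<^esub> n = filt (Suc n)"
  "(x \<oplus>\<^bsub>G\<^esub> y) n = set_add R (x n) (y n)"
  by (simp_all add: assoc_graded_def ideal_power_eq_filt del: ideal_power.simps)

lemma form_zero: "form 0 = \<zero>\<^bsub>G\<^esub>"
  by (rule ext) (simp add: form_def coset_zero G_simps)

lemma form_one: "form 1 = \<one>\<^bsub>G\<^esub>"
proof (rule ext)
  fix n
  have "\<one>\<^bsub>G\<^esub> n = (if n = 0 then coset 0 1 else filt (Suc n))"
    using ideal_power_eq_filt[of "Suc 0"] by (simp add: assoc_graded_def ideal_power_eq_filt del: ideal_power.simps)
  then show "form 1 n = \<one>\<^bsub>G\<^esub> n" by (simp add: form_def coset_zero)
qed

lemma form_add:
  assumes "p \<in> Rees" "q \<in> Rees"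
  shows "form (p + q) = form p \<oplus>\<^bsub>G\<^esub> form q"
  by (rule ext) (simp add: form_def G_simps coset_add Rees_carrier assms)

lemma form_mult:
  assumes "p \<in> Rees" "q \<in> Rees"
  shows "form (p * q) = form p \<otimes>\<^bsub>G\<^esub> form q"
proof (rule ext)
  fix n
  define z where "z i = (if i \<le> n then coeff p i * coeff q (n - i) else 0)" for i
  have z: "z i \<in> filt n" for i
    using filt_mult[OF ReesD[OF assms(1), of i] ReesD[OF assms(2), of "n - i"]] by (auto simp: z_def)
  interpret I: ideal "filt (Suc n)" R by (rule filt_ideal)
  interpret Q: ring "R Quot filt (Suc n)" by (rule I.quotient_is_ring)
  have "(form p \<otimes>\<^bsub>G\<^esub> form q) n = finsum (R Quot filt (Suc n))
      (\<lambda>i. rcoset_mult R (filt (Suc n)) (form p i) (form q (n - i))) {..n}"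
    by (simp add: assoc_graded_def ideal_power_eq_filt del: ideal_power.simps)
  also have "\<dots> = finsum (R Quot filt (Suc n)) (\<lambda>i. coset n (z i)) {..n}"
  proof (rule Q.finsum_cong')
    show "(\<lambda>i. coset n (z i)) \<in> {..n} \<rightarrow> carrier (R Quot filt (Suc n))"
      using a_rcosetsI[OF I.a_subset filt_carrier[OF z]] by (simp add: FactRing_def)
    show "rcoset_mult R (filt (Suc n)) (form p i) (form q (n - i)) = coset n (z i)"
      if "i \<in> {..n}" for i
      using that coset_mult[OF ReesD[OF assms(1), of i] ReesD[OF assms(2), of "n - i"], of n]
      by (simp add: form_def z_def)
  qed simp
  also have "\<dots> = coset n (\<Sum>i\<le>n. z i)" by (rule finsum_cosets) (rule filt_carrier[OF z])
  also have "(\<Sum>i\<le>n. z i) = coeff (p * q) n" unfolding coeff_mult by (rule sum.cong) (auto simp: z_def)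
  finally show "form (p * q) n = (form p \<otimes>\<^bsub>G\<^esub> form q) n"
    by (simp add: form_def[of "p * q" n])
qed

lemma form_eq_iff:
  assumes "p \<in> Rees" "q \<in> Rees"
  shows "form p = form q \<longleftrightarrow> (\<forall>n. coeff (p - q) n \<in> filt (Suc n))"
  using assms by (simp add: fun_eq_iff form_def coset_eq_iff Rees_carrier)

lemma form_eq_zero_iff:
  assumes "p \<in> Rees"
  shows "form p = \<zero>\<^bsub>G\<^esub> \<longleftrightarrow> (\<forall>n. coeff p n \<in> filt (Suc n))"
  using form_eq_iff[OF assms Rees_zero] by (simp add: form_zero)

lemma carrier_G: "carrier G = form ` Rees"
proof (intro equalityI subsetI)
  fix g assume "g \<in> carrier G"
  then have "\<forall>n. \<exists>x. x \<in> filt n \<and> g n = coset n x" and fin: "finite {n. g n \<noteq> filt (Suc n)}"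
    by (auto simp: assoc_graded_def ideal_power_eq_filt simp del: ideal_power.simps)
  then obtain x where x: "\<And>n. x n \<in> filt n" "\<And>n. g n = coset n (x n)" by metis
  obtain N where N: "\<And>n. g n \<noteq> filt (Suc n) \<Longrightarrow> n \<le> N"
    using fin by (metis (mono_tags, lifting) finite_nat_set_iff_bounded_le mem_Collect_eq)
  define y where "y n = (if g n = filt (Suc n) then 0 else x n)" for n
  define p where "p = Abs_poly y"
  have p: "coeff p = y"
    unfolding p_def by (rule coeff_Abs_poly[of N]) (use N in \<open>force simp: y_def\<close>)
  have "p \<in> Rees" using x(1) by (auto simp: Rees_def p y_def)
  moreover have "form p = g" using x(2) by (auto simp: fun_eq_iff form_def p y_def coset_zero)
  ultimately show "g \<in> form ` Rees" by blast
next
  fix g assume "g \<in> form ` Rees"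
  then obtain p where p: "p \<in> Rees" "g = form p" by blast
  have "{n. form p n \<noteq> filt (Suc n)} \<subseteq> {..degree p}"
    by (auto simp: form_def coset_zero intro!: le_degree)
  then have "finite {n. form p n \<noteq> filt (Suc n)}" by (rule finite_subset) simp
  moreover have "\<forall>n. \<exists>x\<in>filt n. form p n = coset n x" using ReesD[OF p(1)] by (auto simp: form_def)
  ultimately show "g \<in> carrier G"
    by (simp add: p(2) assoc_graded_def ideal_power_eq_filt del: ideal_power.simps)
qed

lemma form_in_G [simp]: "p \<in> Rees \<Longrightarrow> form p \<in> carrier G"
  by (simp add: carrier_G)

lemma G_cases:
  assumes "x \<in> carrier G"
  obtains p where "p \<in> Rees" "x = form p"
  using assms by (auto simp: carrier_G)

lemma cring_G: "cring G"
proof (rule cringI)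
  note hom = form_add[symmetric] form_mult[symmetric] Rees_add Rees_mult
  show "abelian_group G"
  proof (rule abelian_groupI)
    show "\<zero>\<^bsub>G\<^esub> \<in> carrier G" using form_in_G[OF Rees_zero] by (simp add: form_zero)
    fix x y z assume "x \<in> carrier G" "y \<in> carrier G" "z \<in> carrier G"
    then show "x \<oplus>\<^bsub>G\<^esub> y \<oplus>\<^bsub>G\<^esub> z = x \<oplus>\<^bsub>G\<^esub> (y \<oplus>\<^bsub>G\<^esub> z)"
      by (elim G_cases) (simp add: hom add.assoc)
  next
    fix x y assume "x \<in> carrier G" "y \<in> carrier G"
    then show "x \<oplus>\<^bsub>G\<^esub> y \<in> carrier G" "x \<oplus>\<^bsub>G\<^esub> y = y \<oplus>\<^bsub>G\<^esub> x"
      by (elim G_cases, simp add: hom add.commute)+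
  next
    fix x assume "x \<in> carrier G"
    then obtain p where p: "p \<in> Rees" "x = form p" by (rule G_cases)
    show "\<zero>\<^bsub>G\<^esub> \<oplus>\<^bsub>G\<^esub> x = x" using p by (simp add: form_zero[symmetric] hom Rees_zero)
    have "form (- p) \<oplus>\<^bsub>G\<^esub> x = \<zero>\<^bsub>G\<^esub>" 
      using form_add[OF Rees_uminus[OF p(1)] p(1)] by (simp add: p(2) form_zero)
    then show "\<exists>y\<in>carrier G. y \<oplus>\<^bsub>G\<^esub> x = \<zero>\<^bsub>G\<^esub>" 
      using Rees_uminus[OF p(1)] by (intro bexI[of _ "form (- p)"]) simp_all
  qed
  show "comm_monoid G"
  proof (rule comm_monoidI)
    show "\<one>\<^bsub>G\<^esub> \<in> carrier G" using form_in_G[OF Rees_one] by (simp add: form_one)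
    fix x y z assume "x \<in> carrier G" "y \<in> carrier G" "z \<in> carrier G"
    then show "x \<otimes>\<^bsub>G\<^esub> y \<otimes>\<^bsub>G\<^esub> z = x \<otimes>\<^bsub>G\<^esub> (y \<otimes>\<^bsub>G\<^esub> z)"
      by (elim G_cases) (simp add: hom mult.assoc)
  next
    fix x y assume "x \<in> carrier G" "y \<in> carrier G"
    then show "x \<otimes>\<^bsub>G\<^esub> y \<in> carrier G" "x \<otimes>\<^bsub>G\<^esub> y = y \<otimes>\<^bsub>G\<^esub> x"
      by (elim G_cases, simp add: hom mult.commute)+
  next
    fix x assume "x \<in> carrier G"
    then show "\<one>\<^bsub>G\<^esub> \<otimes>\<^bsub>G\<^esub> x = x"
      by (elim G_cases) (simp add: form_one[symmetric] hom Rees_one)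
  qed
  fix x y z assume "x \<in> carrier G" "y \<in> carrier G" "z \<in> carrier G"
  then show "(x \<oplus>\<^bsub>G\<^esub> y) \<otimes>\<^bsub>G\<^esub> z = x \<otimes>\<^bsub>G\<^esub> z \<oplus>\<^bsub>G\<^esub> y \<otimes>\<^bsub>G\<^esub> z"
    by (elim G_cases) (simp add: hom distrib_right)
qed

section \<open>The tangent cone over the polynomial ring in its parameter\<close>

text \<open>The substitution \<open>X \<mapsto> t\<^sup>a T\<close>.\<close>

definition lift :: "'k poly \<Rightarrow> 'k fps poly" where
  "lift f = Abs_poly (\<lambda>i. fps_const (coeff f i) * fps_X ^ (i * a))"

lemma coeff_lift: "coeff (lift f) i = fps_const (coeff f i) * fps_X ^ (i * a)"
  unfolding lift_def
  by (subst coeff_Abs_poly[of "degree f"]) (auto simp: coeff_eq_0)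

lemma coeff_lift_filt: "coeff (lift f) i \<in> filt i"
  unfolding coeff_lift
  using mult_in_semigroup_generated_by[OF generator_in_semigroup_generated_by[OF finite_A a_in]]
  by (intro filt_const_mult filt_X_pow) auto

lemma lift_Rees: "lift f \<in> Rees"
  using coeff_lift_filt by (simp add: Rees_def)

lemma lift_add: "lift (f + g) = lift f + lift g"
  by (rule poly_eqI) (simp add: coeff_lift algebra_simps flip: fps_const_add)

lemma lift_mult: "lift (f * g) = lift f * lift g"
proof (rule poly_eqI)
  fix n
  have "coeff (lift f * lift g) n = (\<Sum>i\<le>n. fps_const (coeff f i * coeff g (n - i)) * fps_X ^ (n * a))"
    unfolding coeff_mult
  proof (rule sum.cong[OF refl])
    fix i assume "i \<in> {..n}"
    then have "n * a = i * a + (n - i) * a" by (simp flip: add_mult_distrib)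
    then have "(fps_X :: 'k fps) ^ (n * a) = fps_X ^ (i * a) * fps_X ^ ((n - i) * a)"
      by (simp add: power_add)
    then show "coeff (lift f) i * coeff (lift g) (n - i) =
        fps_const (coeff f i * coeff g (n - i)) * fps_X ^ (n * a)"
      by (simp add: coeff_lift mult_ac flip: fps_const_mult)
  qed
  also have "\<dots> = fps_const (\<Sum>i\<le>n. coeff f i * coeff g (n - i)) * fps_X ^ (n * a)"
    by (rule fps_ext) (simp add: fps_sum_nth sum_distrib_right)
  finally show "coeff (lift (f * g)) n = coeff (lift f * lift g) n"
    by (simp add: coeff_lift coeff_mult)
qed

lemma lift_one: "lift 1 = 1"
  by (rule poly_eqI) (simp add: coeff_lift)

lemma poly_algebra_G: "poly_algebra G (\<lambda>f. form (lift f))"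
proof (intro poly_algebra.intro cring_G poly_algebra_axioms.intro)
  fix f g :: "'k poly"
  show "form (lift f) \<in> carrier G" by (rule form_in_G[OF lift_Rees])
  show "form (lift (f + g)) = form (lift f) \<oplus>\<^bsub>G\<^esub> form (lift g)"
    unfolding lift_add by (rule form_add[OF lift_Rees lift_Rees])
  show "form (lift (f * g)) = form (lift f) \<otimes>\<^bsub>G\<^esub> form (lift g)"
    unfolding lift_mult by (rule form_mult[OF lift_Rees lift_Rees])
  show "form (lift 1) = \<one>\<^bsub>G\<^esub>" by (simp add: lift_one form_one)
qed

text \<open>Let \<open>X\<^sup>d\<close> be the lowest monomial of \<open>f\<close>. In the coefficient of \<open>T\<close> to the power \<open>n + d\<close> of the
  product, every other monomial of \<open>f\<close> meets a component of \<open>y\<close> of degree below \<open>n\<close>, which is zero by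
  induction. What remains is \<open>t\<close> to the power \<open>d a\<close> times the \<open>n\<close>-th component,
  and this factor shifts orders by exactly \<open>d a\<close>.\<close>

lemma lift_nonzerodivisor:
  assumes f: "f \<noteq> 0" and y: "y \<in> carrier G" and eq: "form (lift f) \<otimes>\<^bsub>G\<^esub> y = \<zero>\<^bsub>G\<^esub>"
  shows "y = \<zero>\<^bsub>G\<^esub>"
proof -
  obtain p where p: "p \<in> Rees" "y = form p" using y by (rule G_cases)
  have prod: "coeff (lift f * p) n \<in> filt (Suc n)" for n
    using eq form_eq_zero_iff[OF Rees_mult[OF lift_Rees p(1)]]
    by (simp add: p(2) form_mult[OF lift_Rees p(1)])
  obtain e where "coeff f e \<noteq> 0" using f by (auto simp: poly_eq_iff)
  define d where "d = (LEAST e. coeff f e \<noteq> 0)"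
  have d: "coeff f d \<noteq> 0" unfolding d_def by (rule LeastI) fact
  have below: "coeff f i = 0" if "i < d" for i using not_less_Least that unfolding d_def by blast
  have "coeff p n \<in> filt (Suc n)" for n
  proof (induction n rule: less_induct)
    case (less n)
    let ?t = "\<lambda>i. coeff (lift f) i * coeff p (n + d - i)"
    have rest: "?t i \<in> filt (Suc (n + d))" if i: "i \<in> {..n + d} - {d}" for i
    proof (cases "i < d")
      case True
      then show ?thesis using below by (simp add: coeff_lift)
    next
      case False
      then have "n + d - i < n" using i by auto
      then have "?t i \<in> filt (i + Suc (n + d - i))"
        using less by (intro filt_mult coeff_lift_filt) blast
      then show ?thesis using i by simp
    qed
    have "coeff (lift f * p) (n + d) = ?t d + sum ?t ({..n + d} - {d})"
      unfolding coeff_mult by (rule sum.remove) auto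
    then have "?t d = coeff (lift f * p) (n + d) - sum ?t ({..n + d} - {d})" by simp
    also have "\<dots> \<in> filt (Suc (n + d))" by (rule filt_diff[OF prod filt_sum[OF rest]])
    finally have t: "fps_const (coeff f d) * fps_X ^ (d * a) * coeff p n \<in> filt (Suc (n + d))"
      by (simp add: coeff_lift)
    show ?case
    proof (rule filtI)
      fix s assume s: "fps_nth (coeff p n) s \<noteq> 0"
      have "fps_nth (fps_const (coeff f d) * fps_X ^ (d * a) * coeff p n) (s + d * a)
          = coeff f d * fps_nth (coeff p n) s"
        by (simp add: mult.assoc fps_X_power_mult_nth)
      then have "Suc (n + d) * a \<le> s + d * a" using filtD[OF t, of "s + d * a"] s d by simp
      then have "Suc n * a \<le> s" by (simp add: add_mult_distrib)
      then show "s \<in> \<Gamma> \<and> Suc n * a \<le> s" using filtD[OF ReesD[OF p(1)] s] by simp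
    qed
  qed
  then show ?thesis using form_eq_zero_iff[OF p(1)] p(2) by simp
qed

text \<open>The excess of the order over \<open>a\<close> times the degree adds up under multiplication. It is at least one
  for \<open>q\<close>, so at least \<open>a\<close> for the \<open>a\<close>-th power, which suffices to enter the next step of the
  filtration.\<close>

lemma form_nilpotent:
  assumes q: "q \<in> Rees" and gap: "\<And>n s. fps_nth (coeff q n) s \<noteq> 0 \<Longrightarrow> n * a < s"
  shows "form q \<in> nilradical G"
proof -
  interpret G: cring G by (rule cring_G)
  have pow: "q ^ k \<in> Rees \<and> form q [^]\<^bsub>G\<^esub> k = form (q ^ k)" for k
  proof (induction k)
    case 0
    then show ?case by (simp add: Rees_one form_one)
  next
    case (Suc k)
    then show ?case
      using q Rees_mult[OF q, of "q ^ k"] form_mult[OF q, of "q ^ k"]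
      by (simp add: G.m_comm)
  qed
  have order: "n * a + k \<le> s" if "fps_nth (coeff (q ^ k) n) s \<noteq> 0" for k n s
    using that
  proof (induction k arbitrary: n s)
    case 0
    then show ?case by (cases "n = 0") auto
  next
    case (Suc k)
    have "(\<Sum>i\<le>n. fps_nth (coeff q i * coeff (q ^ k) (n - i)) s) \<noteq> 0"
      using Suc.prems by (simp add: coeff_mult fps_sum_nth)
    then obtain i where i: "i \<in> {..n}" "fps_nth (coeff q i * coeff (q ^ k) (n - i)) s \<noteq> 0"
      by (rule sum.not_neutral_contains_not_neutral)
    obtain u v where uv: "s = u + v" "fps_nth (coeff q i) u \<noteq> 0" "fps_nth (coeff (q ^ k) (n - i)) v \<noteq> 0"
      using i(2) by (rule fps_mult_nth_nonzeroE)
    have "i * a + (n - i) * a = n * a" using i(1) by (simp flip: add_mult_distrib)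
    then show ?case using gap[OF uv(2)] Suc.IH[OF uv(3)] uv(1) by linarith
  qed
  have "coeff (q ^ a) n \<in> filt (Suc n)" for n
    using pow[of a] order[of a n] ReesD[of "q ^ a" n] filtD by (intro filtI) fastforce
  then have "form q [^]\<^bsub>G\<^esub> a = \<zero>\<^bsub>G\<^esub>" using pow[of a] form_eq_zero_iff by simp
  then show ?thesis using q unfolding nilradical_def by auto
qed

text \<open>In degree \<open>n\<close> the polynomial part takes the coefficient of \<open>t\<close> to the power \<open>n a\<close>, the lowest
  exponent that can occur.\<close>

lemma G_decomposition:
  assumes "y \<in> carrier G"
  shows "\<exists>f. \<exists>z\<in>nilradical G. y = form (lift f) \<oplus>\<^bsub>G\<^esub> z"
proof -
  obtain p where p: "p \<in> Rees" "y = form p" using assms by (rule G_cases)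
  define f where "f = Abs_poly (\<lambda>n. fps_nth (coeff p n) (n * a))"
  have f: "coeff f n = fps_nth (coeff p n) (n * a)" for n
    unfolding f_def by (subst coeff_Abs_poly[of "degree p"]) (auto simp: coeff_eq_0)
  define q where "q = p - lift f"
  have q: "q \<in> Rees" unfolding q_def by (rule Rees_diff[OF p(1) lift_Rees])
  have "n * a < s" if "fps_nth (coeff q n) s \<noteq> 0" for n s
  proof -
    have "n * a \<le> s" using filtD[OF ReesD[OF q] that] by simp
    moreover have "fps_nth (coeff q n) (n * a) = 0"
      by (simp add: q_def coeff_lift f fps_X_power_iff)
    ultimately show ?thesis using that by (cases "s = n * a") auto
  qed
  then have "form q \<in> nilradical G" by (rule form_nilpotent[OF q])
  moreover have "y = form (lift f) \<oplus>\<^bsub>G\<^esub> form q"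
    using form_add[OF lift_Rees q, of f] by (simp add: p(2) q_def)
  ultimately show ?thesis by blast
qed

text \<open>The Apery set of \<open>a\<close>: a minimal system of generators of the semigroup as a set acted on by
  translation by \<open>a\<close>. Each residue class modulo \<open>a\<close> contributes at most one element.\<close>

definition apery :: "nat set" where
  "apery = {s \<in> \<Gamma>. a \<le> s \<longrightarrow> s - a \<notin> \<Gamma>}"

lemma finite_apery: "finite apery"
proof -
  have "s = s'" if s: "s \<in> apery" "s' \<in> apery" "s mod a = s' mod a" "s \<le> s'" for s s'
  proof (rule ccontr)
    assume "s \<noteq> s'"
    have "a dvd s' - s" using mod_eq_dvd_iff_nat[OF s(4), of a] s(3) by simp
    then obtain k where "s' - s = a * k" by (elim dvdE)
    then have k: "s' = s + a * k" using s(4) by simp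
    then obtain k' where k': "k = Suc k'" using \<open>s \<noteq> s'\<close> by (cases k) auto
    have "s' - a = s + k' * a" by (simp add: k k' mult.commute)
    also have "\<dots> \<in> \<Gamma>"
      using s(1) generator_in_semigroup_generated_by[OF finite_A a_in]
      by (auto simp: apery_def intro: semigroup_generated_by_add mult_in_semigroup_generated_by)
    finally show False using s(2) by (simp add: apery_def k k')
  qed
  then have "inj_on (\<lambda>s. s mod a) apery"
    unfolding inj_on_def by (metis linear)
  moreover have "(\<lambda>s. s mod a) ` apery \<subseteq> {..<a}" using a_pos by auto
  ultimately show ?thesis using finite_subset finite_imageD by blast
qed

definition initial_form :: "nat \<Rightarrow> nat \<Rightarrow> 'k fps set" where
  "initial_form s = form (monom (fps_X ^ s) (s div a))"

lemma monom_Rees: "s \<in> \<Gamma> \<Longrightarrow> monom (fps_X ^ s) (s div a) \<in> Rees"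
  by (intro Rees_monom filt_X_pow) (auto simp: mult.commute)

text \<open>Modulo the next step of the filtration, the component in degree \<open>n\<close> only involves exponents \<open>s\<close>
  with \<open>s div a = n\<close>. So every class is a finite linear combination of initial forms of powers of
  \<open>t\<close>, and subtracting \<open>a\<close> from the exponent amounts to dividing by the parameter as long as the
  exponent stays in the semigroup.\<close>

lemma G_finite: "\<exists>es. set es \<subseteq> carrier G \<and> carrier G \<subseteq> poly_algebra.poly_span G (\<lambda>f. form (lift f)) es"
proof -
  interpret G: poly_algebra G "\<lambda>f. form (lift f)" by (rule poly_algebra_G)
  define es where "es = map initial_form (sorted_list_of_set apery)"
  have set_es: "set es = initial_form ` apery" by (simp add: es_def finite_apery)
  have es: "set es \<subseteq> carrier G"
    unfolding set_es initial_form_def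
    by (intro image_subsetI form_in_G monom_Rees) (simp add: apery_def)
  let ?Sp = "G.poly_span es"
  note Sp = G.submoduleD[OF G.poly_span_submodule[OF es]]
  have initial: "initial_form s \<in> ?Sp" if "s \<in> \<Gamma>" for s
    using that
  proof (induction s rule: less_induct)
    case (less s)
    show ?case
    proof (cases "s \<in> apery")
      case True
      then show ?thesis by (intro G.generator_in_poly_span[OF es]) (simp add: set_es)
    next
      case False
      then have s: "a \<le> s" "s - a \<in> \<Gamma>" using less.prems by (auto simp: apery_def)
      have "lift [:0, 1:] = monom (fps_X ^ a) 1"
        by (rule poly_eqI) (simp add: coeff_lift coeff_pCons split: nat.split)
      then have "lift [:0, 1:] * monom (fps_X ^ (s - a)) ((s - a) div a) = monom (fps_X ^ s) (s div a)"
        using s(1) a_pos by (simp add: mult_monom le_div_geq flip: power_add)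
      then have "initial_form s = form (lift [:0, 1:]) \<otimes>\<^bsub>G\<^esub> initial_form (s - a)"
        using form_mult[OF lift_Rees monom_Rees[OF s(2)], of "[:0, 1:]"] by (simp add: initial_form_def)
      then show ?thesis using less.IH[of "s - a"] s a_pos Sp(4) by simp
    qed
  qed
  have "carrier G \<subseteq> ?Sp"
  proof
    fix y assume "y \<in> carrier G"
    then obtain p where p: "p \<in> Rees" "y = form p" by (rule G_cases)
    define T where "T = {s \<in> \<Gamma>. s < Suc (degree p) * a}"
    have finT: "finite T" by (simp add: T_def)
    define c where "c s = fps_nth (coeff p (s div a)) s" for s
    define m where "m s = lift [:c s:] * monom (fps_X ^ s) (s div a)" for s
    have lift_const: "lift [:c s:] = [:fps_const (c s):]" for s
      by (rule poly_eqI) (simp add: coeff_lift coeff_pCons split: nat.split)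
    have m: "m s \<in> Rees" "form (m s) \<in> ?Sp" if "s \<in> T" for s
    proof -
      have s: "s \<in> \<Gamma>" using that by (simp add: T_def)
      show "m s \<in> Rees" unfolding m_def by (rule Rees_mult[OF lift_Rees monom_Rees[OF s]])
      show "form (m s) \<in> ?Sp"
        using form_mult[OF lift_Rees monom_Rees[OF s]] Sp(4)[OF initial[OF s]]
        by (simp add: m_def initial_form_def)
    qed
    have sum_span: "form (sum m T') \<in> ?Sp" if "T' \<subseteq> T" for T'
      using finite_subset[OF that finT] that
    proof (induction T' rule: finite_induct)
      case empty
      then show ?case using Sp(2) by (simp add: form_zero)
    next
      case (insert s T')
      then have "sum m T' \<in> Rees" using m(1) by (intro Rees_sum) auto
      then show ?case using insert m[of s] Sp(3) by (simp add: form_add)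
    qed
    have "coeff (p - sum m T) n \<in> filt (Suc n)" for n
    proof (rule filtI)
      fix s assume s: "fps_nth (coeff (p - sum m T) n) s \<noteq> 0"
      have "p - sum m T \<in> Rees" using m(1) p(1) by (intro Rees_diff Rees_sum) auto
      then have sn: "s \<in> \<Gamma>" "n * a \<le> s" using filtD[OF ReesD s] by auto
      have "fps_nth (coeff (m i) n) s = (if i = s then if s div a = n then c s else 0 else 0)" for i
        by (auto simp: m_def lift_const smult_monom fps_X_power_iff)
      then have "fps_nth (coeff (sum m T) n) s = (if s \<in> T then if s div a = n then c s else 0 else 0)"
        using finT by (simp add: coeff_sum fps_sum_nth)
      then have "fps_nth (coeff p n) s \<noteq> (if s \<in> T \<and> s div a = n then fps_nth (coeff p n) s else 0)"
        using s by (auto simp: c_def split: if_splits)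
      then have ne: "fps_nth (coeff p n) s \<noteq> 0" "\<not> (s \<in> T \<and> s div a = n)" by (auto split: if_splits)
      have "n \<le> degree p" using ne(1) by (intro le_degree) auto
      have "Suc n * a \<le> s"
      proof (rule ccontr)
        assume "\<not> Suc n * a \<le> s"
        then have "s < Suc n * a" by simp
        moreover have "Suc n * a \<le> Suc (degree p) * a" using \<open>n \<le> degree p\<close> by (intro mult_le_mono) auto
        ultimately have "s < Suc (degree p) * a" by (rule less_le_trans)
        then have "s \<in> T" using sn(1) unfolding T_def by blast
        moreover have "s div a = n" using sn(2) \<open>s < Suc n * a\<close> by (intro div_nat_eqI) (auto simp: mult.commute)
        ultimately show False using ne(2) by blast
      qed
      then show "s \<in> \<Gamma> \<and> Suc n * a \<le> s" using sn by simp
    qed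
    then have "y = form (sum m T)"
      using form_eq_iff[OF p(1) Rees_sum[of T m]] m(1) p(2) by simp
    then show "y \<in> ?Sp" using sum_span by blast
  qed
  then show ?thesis using es by blast
qed

theorem cohen_macaulay_tangent_cone: "cohen_macaulay (tangent_cone A :: (nat \<Rightarrow> 'k fps set) ring)"
proof -
  have "tangent_cone A = G"
    unfolding tangent_cone_def max_ideal_eq_filt[symmetric] R_def ..
  then show ?thesis
    using poly_algebra.cohen_macaulay_of_regular_poly_subring[OF poly_algebra_G]
      G_finite lift_nonzerodivisor G_decomposition by metis
qed

end


section \<open>The semigroup with five generators\<close>

lemma split_off_generator:
  assumes A: "finite A" "\<And>b. b \<in> A \<Longrightarrow> a \<le> b" and u: "u \<in> factorizations A s"
    and r: "Suc r \<le> (\<Sum>b\<in>A. u b)"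
  shows "\<exists>b\<in>A. b \<le> s \<and> s - b \<in> semigroup_generated_by A \<and> r * a \<le> s - b"
proof -
  have "\<exists>b\<in>A. u b \<noteq> 0" using r by (metis Suc_n_not_le_n le_trans sum.neutral zero_le)
  then obtain b where b: "b \<in> A" "u b \<noteq> 0" by blast
  define v where "v = u(b := u b - 1)"
  have rest: "(\<Sum>c\<in>A - {b}. v c * c) = (\<Sum>c\<in>A - {b}. u c * c)" "sum v (A - {b}) = sum u (A - {b})"
    by (auto simp: v_def intro: sum.cong)
  have "s = u b * b + (\<Sum>c\<in>A - {b}. u c * c)"
    using u sum.remove[OF A(1) b(1), of "\<lambda>c. u c * c"] by (simp add: factorizations_def)
  moreover have "(\<Sum>c\<in>A. v c * c) = (u b - 1) * b + (\<Sum>c\<in>A - {b}. u c * c)"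
    using rest by (simp add: sum.remove[OF A(1) b(1)] v_def)
  moreover have "u b * b = b + (u b - 1) * b" using b(2) by (cases "u b") auto
  ultimately have s: "s = b + (\<Sum>c\<in>A. v c * c)" by simp
  then have "v \<in> factorizations A (s - b)" using u b(1) by (auto simp: factorizations_def v_def)
  moreover have "r * a \<le> s - b"
  proof -
    have "Suc (sum v A) = sum u A"
      using rest b by (simp add: sum.remove[OF A(1) b(1)] v_def)
    then have "r * a \<le> (\<Sum>c\<in>A. v c) * a" using r by (intro mult_le_mono1) simp
    also have "\<dots> \<le> (\<Sum>c\<in>A. v c * c)"
      unfolding sum_distrib_right using A(2) by (intro sum_mono mult_le_mono2)
    finally show ?thesis using s by simp
  qed
  ultimately show ?thesis using b s unfolding semigroup_generated_by_def by (intro bexI[of _ b]) auto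
qed

text \<open>With \<open>j\<close> large offsets \<open>n + 2\<close> or \<open>n + 3\<close> and \<open>k - j\<close> small ones \<open>0\<close>, \<open>1\<close>, \<open>2\<close>, the reachable sums
  are those from \<open>j (n + 2)\<close> to \<open>j (n + 2) + j + 2 (k - j)\<close>. As \<open>j\<close> varies, these intervals
  leave no gaps when \<open>n \<le> k\<close>.\<close>

lemma consecutive_sums:
  fixes n k e a :: nat
  assumes A: "finite A" "{a, a + 1, a + 2, a + n + 2, a + n + 3} \<subseteq> A"
    and k: "n \<le> k" and e: "e \<le> k * (n + 3)"
  shows "k * a + e \<in> semigroup_generated_by A"
proof -
  have combination: "i0 * a + i1 * (a + 1) + i2 * (a + 2) + i3 * (a + n + 2) + i4 * (a + n + 3)
      \<in> semigroup_generated_by A" for i0 i1 i2 i3 i4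
    using A(2) by (intro semigroup_generated_by_add mult_in_semigroup_generated_by
        generator_in_semigroup_generated_by[OF A(1)]) auto
  show ?thesis
  proof (cases "k * (n + 2) \<le> e")
    case True
    define x where "x = e - k * (n + 2)"
    have x: "e = k * (n + 2) + x" "x \<le> k" using True e by (auto simp: x_def algebra_simps)
    then obtain y where "k = x + y" using le_Suc_ex by blast
    then have "k * a + e = 0 * a + 0 * (a + 1) + 0 * (a + 2) + y * (a + n + 2) + x * (a + n + 3)"
      unfolding x(1) by (simp add: algebra_simps)
    then show ?thesis using combination[of 0 0 0 y x] by simp
  next
    case False
    define j t where "j = e div (n + 2)" and "t = e mod (n + 2)"
    have e_eq: "e = j * (n + 2) + t" unfolding j_def t_def by (simp only: div_mult_mod_eq)
    have "j < k" using False by (simp add: j_def less_mult_imp_div_less)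
    have "t < n + 2" by (simp add: t_def)
    \<comment> \<open>Raise \<open>x\<close> of the \<open>j\<close> large offsets from \<open>n + 2\<close> to \<open>n + 3\<close>, then cover the rest by
      offsets \<open>2\<close> and at most one offset \<open>1\<close>.\<close>
    define x where "x = min t j"
    define z where "z = (t - x) div 2"
    define y where "y = (t - x) mod 2"
    have t: "t = x + y + 2 * z" by (simp add: x_def y_def z_def)
    have "x \<le> j" by (simp add: x_def)
    have "y + z \<le> k - j"
    proof (cases "t \<le> j")
      case False
      then have "t - x \<le> 2 * (k - j) " using \<open>t < n + 2\<close> k \<open>j < k\<close> by (simp add: x_def)
      moreover have "w mod 2 + w div 2 \<le> q" if "w \<le> 2 * q" for w q :: nat
        using that by presburger
      ultimately show ?thesis unfolding y_def z_def by blast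
    qed (simp add: x_def y_def z_def)
    then obtain c0 where c0: "k - j = y + z + c0" using le_Suc_ex by blast
    obtain c3 where c3: "j = x + c3" using \<open>x \<le> j\<close> le_Suc_ex by blast
    have keq: "k = x + c3 + y + z + c0" using c0 c3 \<open>j < k\<close> by simp
    have "k * a + e = c0 * a + y * (a + 1) + z * (a + 2) + c3 * (a + n + 2) + x * (a + n + 3)"
      unfolding e_eq t keq c3 by (simp add: algebra_simps)
    then show ?thesis using combination by simp
  qed
qed

text \<open>If the given factorization is too short, the smallest generator \<open>a\<close> itself can be split off: the
  factorization has more than \<open>n\<close> terms, since its offsets sum to at least \<open>a > n (n + 3)\<close>, and then
  the filled intervals of offset sums provide a factorization of \<open>s - a\<close> into \<open>r\<close> generators.\<close>

lemma split_generator_of_order: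
  fixes n :: nat
  defines "a \<equiv> n^2 + 3*n + 1"
  defines "A \<equiv> {a, a + 1, a + 2, a + n + 2, a + n + 3}"
  assumes s: "s \<in> semigroup_generated_by A" and r: "Suc r * a \<le> s"
  shows "\<exists>b\<in>A. b \<le> s \<and> s - b \<in> semigroup_generated_by A \<and> r * a \<le> s - b"
proof -
  obtain u where u: "u \<in> factorizations A s" using s by (auto simp: semigroup_generated_by_def)
  have A: "finite A" "\<And>b. b \<in> A \<Longrightarrow> a \<le> b" by (auto simp: A_def)
  show ?thesis
  proof (cases "Suc r \<le> sum u A")
    case True
    then show ?thesis using split_off_generator[OF A u] by blast
  next
    case False
    define l where "l = sum u A"
    define e where "e = (\<Sum>b\<in>A. u b * (b - a))"
    have "s = (\<Sum>b\<in>A. u b * b)" using u by (simp add: factorizations_def)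
    also have "\<dots> = (\<Sum>b\<in>A. u b * a + u b * (b - a))"
      using A(2) by (intro sum.cong refl) (simp flip: add_mult_distrib2)
    finally have s_eq: "s = l * a + e" by (simp add: l_def e_def sum.distrib sum_distrib_right)
    have e_le: "e \<le> l * (n + 3)"
      unfolding e_def l_def sum_distrib_right by (intro sum_mono mult_le_mono2) (auto simp: A_def)
    have lr: "l \<le> r" using False by (simp add: l_def)
    then have "Suc l * a \<le> s" using r by (meson Suc_le_mono le_trans mult_le_mono1)
    then have "a \<le> l * (n + 3)" using s_eq e_le by simp
    have "n \<le> l"
    proof (rule ccontr)
      assume "\<not> n \<le> l"
      then have "l * (n + 3) \<le> n * (n + 3)" by (intro mult_le_mono1) simp
      then show False using \<open>a \<le> l * (n + 3)\<close> by (simp add: a_def power2_eq_square algebra_simps)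
    qed
    define e' where "e' = s - Suc r * a"
    have e': "s = Suc r * a + e'" using r by (simp add: e'_def)
    have "l * a \<le> r * a" using lr by (rule mult_le_mono1)
    then have "e' \<le> l * (n + 3)" using e' s_eq e_le mult_Suc[of r a] by linarith
    also have "\<dots> \<le> r * (n + 3)" using lr by (rule mult_le_mono1)
    finally have "r * a + e' \<in> semigroup_generated_by A"
      using consecutive_sums[of A a n r e'] A(1) \<open>n \<le> l\<close> lr by (simp add: A_def)
    moreover have "s - a = r * a + e'" using e' by simp
    ultimately show ?thesis using e' by (intro bexI[of _ a]) (auto simp: A_def)
  qed
qed

theorem corollary5p16:
  fixes n :: nat
  assumes "n \<ge> 8" and "even n"
  shows "cohen_macaulay
    (tangent_cone {n^2 + 3*n + 1, n^2 + 3*n + 2, n^2 + 3*n + 3, n^2 + 4*n + 3, n^2 + 4*n + 4}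
       :: (nat \<Rightarrow> 'k::field fps set) ring)"
proof -
  define a where "a = n^2 + 3*n + 1"
  define A where "A = {a, a + 1, a + 2, a + n + 2, a + n + 3}"
  have "order_filtered_semigroup_ring A a (semigroup_ring A :: 'k fps ring)"
  proof
    show "\<exists>b\<in>A. b \<le> s \<and> s - b \<in> semigroup_generated_by A \<and> r * a \<le> s - b"
      if "s \<in> semigroup_generated_by A" "Suc r * a \<le> s" for s r
      using split_generator_of_order[of s n r] that unfolding A_def a_def by blast
  qed (auto simp: A_def a_def)
  then have "cohen_macaulay (tangent_cone A :: (nat \<Rightarrow> 'k fps set) ring)"
    by (rule order_filtered_semigroup_ring.cohen_macaulay_tangent_cone)
  moreover have "A = {n^2 + 3*n + 1, n^2 + 3*n + 2, n^2 + 3*n + 3, n^2 + 4*n + 3, n^2 + 4*n + 4}"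
  proof -
    have "a + 1 = n^2 + 3*n + 2" "a + 2 = n^2 + 3*n + 3"
      "a + n + 2 = n^2 + 4*n + 3" "a + n + 3 = n^2 + 4*n + 4"
      by (simp_all add: a_def)
    then show ?thesis unfolding A_def by (simp only: refl) (simp only: a_def)
  qed
  ultimately show ?thesis by simp
qed

end
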